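(* Let $0<q<1$. Let $\mathbf{u}\in\mathcal{P}^*$ be a regular functional and let $(P_n)_{n\ge0}$ be the corresponding monic orthogonal polynomial sequence, with $P_{-1}:=0$. Then there exists a sequence of complex numbers $(k_n)_{n\ge0}$ such that $$\mathcal{S}_q\mathcal{D}_qP_n(z)=k_nP_{n-1}(z)\qquad(n=0,1,2,\ldots)$$ if and only if there is $s\in\{1,-1\}$ such that $\mathbf{u}$ satisfies the functional equations \begin{align*} (q^s-1)\mathbf{D}_q\mathbf{S}_q\mathbf{u}&=2z\,\mathbf{u},\\ 2q^{3s/2}\,\mathbf{D}_q^2\big(U_2\mathbf{u}\big)&=-(2z^2+q^s-1)\,\mathbf{u},\\ 2q^s\,\mathbf{S}_q^2\mathbf{u}&=\big(-2z^2+1+q^s\big)\mathbf{u},\\ 8q^{5s/2}\,\mathbf{S}_q\mathbf{D}_q\big(U_2\mathbf{u}\big)&=(1-q^s)\,z\,(-4z^2+q^{2s}+3)\,\mathbf{u}, \end{align*} where $U_2(z)=(\alpha^2-1)(z^2-1)$ and $\alpha=\frac12(q^{1/2}+q^{-1/2})$.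
   Context: Let $\mathcal{P}$ be the space of polynomials in one variable $z$ with complex coefficients and $\mathcal{P}^*$ its algebraic dual. For $p\in\mathcal{P}$, with $z=x(\sigma)=\frac12(q^{\sigma}+q^{-\sigma})$, the Askey-Wilson operator $\mathcal{D}_q$ and the averaging operator $\mathcal{S}_q$ are the linear maps $\mathcal{P}\to\mathcal{P}$ defined by $$\mathcal{D}_q p(x(\sigma))=\frac{p(x(\sigma+\frac12))-p(x(\sigma-\frac12))}{x(\sigma+\frac12)-x(\sigma-\frac12)},\qquad \mathcal{S}_q p(x(\sigma))=\tfrac12\Big(p(x(\sigma+\tfrac12))+p(x(\sigma-\tfrac12))\Big).$$ On $\mathcal{P}^*$ define linear operators $\mathbf{D}_q,\mathbf{S}_q$ by $\langle\mathbf{D}_q\mathbf{w},f\rangle=-\langle\mathbf{w},\mathcal{D}_qf\rangle$ and $\langle\mathbf{S}_q\mathbf{w},f\rangle=\langle\mathbf{w},\mathcal{S}_qf\rangle$ for $f\in\mathcal{P}$, and the product of a polynomial $g$ with $\mathbf{w}\in\mathcal{P}^*$ by $\langle g\mathbf{w},f\rangle=\langle\mathbf{w},gf\rangle$. Squares of operators denote composition, and $z$ denotes the polynomial variable. A functional $\mathbf{u}\in\mathcal{P}^*$ is regular if there is a (then unique) sequence of monic polynomials $(P_n)_{n\ge0}$, $\deg P_n=n$, with $\langle\mathbf{u},P_jP_n\rangle=h_n\delta_{j,n}$ and $h_n\in\mathbb{C}\setminus\{0\}$ for all $j,n\ge0$; $(P_n)_{n\ge0}$ is the monic orthogonal polynomial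 sequence corresponding to $\mathbf{u}$. *)

theory Defs
  imports "HOL-Analysis.Analysis" "HOL-Computational_Algebra.Polynomial"
begin

section \<open>The Askey-Wilson and averaging operators on polynomials\<close>

definition aw_x :: "real \<Rightarrow> complex \<Rightarrow> complex" where
  "aw_x q \<sigma> = (of_real q powr \<sigma> + of_real q powr (- \<sigma>)) / 2"

definition aw_alpha :: "real \<Rightarrow> real" where
  "aw_alpha q = (q powr (1/2) + q powr (- 1/2)) / 2"

definition aw_U2 :: "real \<Rightarrow> complex poly" where
  "aw_U2 q = smult (of_real ((aw_alpha q)\<^sup>2 - 1)) [:- 1, 0, 1:]"

text \<open>
  Both operators are given by their values on the lattice \<open>z = x(\<sigma>)\<close>, with \<open>\<sigma>\<close> complex; for the
  divided difference, only at those \<open>\<sigma>\<close> where the denominator does not vanish. The polynomials are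
  thereby uniquely determined; see \<open>ex1_aw_D\<close> and \<open>ex1_aw_S\<close> below.
\<close>

definition aw_D :: "real \<Rightarrow> complex poly \<Rightarrow> complex poly" where
  "aw_D q p = (THE r. \<forall>\<sigma>. aw_x q (\<sigma> + 1/2) \<noteq> aw_x q (\<sigma> - 1/2) \<longrightarrow>
     poly r (aw_x q \<sigma>) =
       (poly p (aw_x q (\<sigma> + 1/2)) - poly p (aw_x q (\<sigma> - 1/2))) /
       (aw_x q (\<sigma> + 1/2) - aw_x q (\<sigma> - 1/2)))"

definition aw_S :: "real \<Rightarrow> complex poly \<Rightarrow> complex poly" where
  "aw_S q p = (THE r. \<forall>\<sigma>. poly r (aw_x q \<sigma>) =
     (poly p (aw_x q (\<sigma> + 1/2)) + poly p (aw_x q (\<sigma> - 1/2))) / 2)"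


section \<open>Functionals on polynomials\<close>

definition poly_dual :: "(complex poly \<Rightarrow> complex) set" where
  "poly_dual = {w. Vector_Spaces.linear smult (*) w}"

definition dual_D :: "real \<Rightarrow> (complex poly \<Rightarrow> complex) \<Rightarrow> (complex poly \<Rightarrow> complex)" where
  "dual_D q w = (\<lambda>f. - w (aw_D q f))"

definition dual_S :: "real \<Rightarrow> (complex poly \<Rightarrow> complex) \<Rightarrow> (complex poly \<Rightarrow> complex)" where
  "dual_S q w = (\<lambda>f. w (aw_S q f))"

definition dual_mult :: "complex poly \<Rightarrow> (complex poly \<Rightarrow> complex) \<Rightarrow> (complex poly \<Rightarrow> complex)" where
  "dual_mult g w = (\<lambda>f. w (g * f))"

definition dual_scale :: "complex \<Rightarrow> (complex poly \<Rightarrow> complex) \<Rightarrow> (complex poly \<Rightarrow> complex)" where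
  "dual_scale c w = (\<lambda>f. c * w f)"

definition monic_OPS :: "(complex poly \<Rightarrow> complex) \<Rightarrow> (nat \<Rightarrow> complex poly) \<Rightarrow> bool" where
  "monic_OPS u P \<longleftrightarrow>
     (\<forall>n. degree (P n) = n \<and> lead_coeff (P n) = 1) \<and>
     (\<exists>h :: nat \<Rightarrow> complex. (\<forall>n. h n \<noteq> 0) \<and>
        (\<forall>j n. u (P j * P n) = (if j = n then h n else 0)))"

definition regular_functional :: "(complex poly \<Rightarrow> complex) \<Rightarrow> bool" where
  "regular_functional u \<longleftrightarrow> (\<exists>P. monic_OPS u P)"


section \<open>The operators are well defined\<close>

lemma aw_x_shift:
  assumes "0 < q"
  defines "r \<equiv> complex_of_real (q powr (1/2))" and "t \<equiv> \<lambda>\<sigma>. complex_of_real q powr \<sigma>"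
  shows "aw_x q \<sigma> = (t \<sigma> + 1 / t \<sigma>) / 2"
    and "aw_x q (\<sigma> + 1/2) = (t \<sigma> * r + 1 / (t \<sigma> * r)) / 2"
    and "aw_x q (\<sigma> - 1/2) = (t \<sigma> / r + r / t \<sigma>) / 2"
    and "t \<sigma> \<noteq> 0" "r \<noteq> 0"
    and "of_real (aw_alpha q) = (r + 1 / r) / 2"
proof -
  have r: "complex_of_real q powr (1/2) = r"
    using powr_of_real[of q "1/2"] assms(1) by (simp add: r_def)
  have r': "q powr (- 1/2) = 1 / q powr (1/2)"
    using powr_minus_divide[of q "1/2"] by simp
  show nz: "t \<sigma> \<noteq> 0" "r \<noteq> 0" using assms(1) by (auto simp: t_def r_def)
  show "aw_x q \<sigma> = (t \<sigma> + 1 / t \<sigma>) / 2"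
    by (simp add: aw_x_def t_def powr_minus_divide)
  have p: "t (\<sigma> + 1/2) = t \<sigma> * r" using r by (simp add: t_def powr_add)
  have m: "t (\<sigma> - 1/2) = t \<sigma> / r" using r by (simp add: t_def powr_diff)
  show "aw_x q (\<sigma> + 1/2) = (t \<sigma> * r + 1 / (t \<sigma> * r)) / 2"
    using p unfolding aw_x_def powr_minus_divide t_def by simp
  show "aw_x q (\<sigma> - 1/2) = (t \<sigma> / r + r / t \<sigma>) / 2"
    using m unfolding aw_x_def powr_minus_divide t_def by simp
  show "of_real (aw_alpha q) = (r + 1 / r) / 2"
    using r' by (simp add: aw_alpha_def r_def)
qed

lemma aw_x_sum:
  assumes "0 < q"
  shows "(aw_x q (\<sigma> + 1/2) + aw_x q (\<sigma> - 1/2)) / 2 = of_real (aw_alpha q) * aw_x q \<sigma>"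
proof -
  have "((t * r + 1 / (t * r)) / 2 + (t / r + r / t) / 2) / 2 = (r + 1 / r) / 2 * ((t + 1 / t) / 2)"
    if "t \<noteq> 0" "r \<noteq> 0" for t r :: complex
    using that by (simp add: field_simps)
  then show ?thesis
    unfolding aw_x_shift(2,3,6)[OF assms] aw_x_shift(1)[OF assms, of \<sigma>]
    using aw_x_shift(4,5)[OF assms] by blast
qed

lemma aw_x_diff:
  assumes "0 < q"
  shows "((aw_x q (\<sigma> + 1/2) - aw_x q (\<sigma> - 1/2)) / 2)\<^sup>2 = poly (aw_U2 q) (aw_x q \<sigma>)"
proof -
  have "(((t * r + 1 / (t * r)) / 2 - (t / r + r / t) / 2) / 2)\<^sup>2
      = (((r + 1 / r) / 2)\<^sup>2 - 1) * (((t + 1 / t) / 2)\<^sup>2 - 1)"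
    if "t \<noteq> 0" "r \<noteq> 0" for t r :: complex
  proof -
    have 1: "((t * r + 1 / (t * r)) / 2 - (t / r + r / t) / 2) / 2 = (r - 1 / r) / 2 * ((t - 1 / t) / 2)"
      using that by (simp add: field_simps)
    have 2: "((w - 1 / w) / 2)\<^sup>2 = ((w + 1 / w) / 2)\<^sup>2 - 1" if "w \<noteq> 0" for w :: complex
      using that by (simp add: field_simps power2_eq_square)
    show ?thesis unfolding 1 power_mult_distrib 2[OF that(1)] 2[OF that(2)] ..
  qed
  moreover have "poly (aw_U2 q) z = ((of_real (aw_alpha q))\<^sup>2 - 1) * (z\<^sup>2 - 1)" for z
    by (simp add: aw_U2_def power2_eq_square algebra_simps)
  ultimately show ?thesis
    unfolding aw_x_shift(2,3)[OF assms] aw_x_shift(1)[OF assms, of \<sigma>]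
    by (simp only: aw_x_shift(4,5,6)[OF assms] not_False_eq_True)
qed

lemma aw_operators_exist:
  assumes "0 < q"
  shows "\<exists>d s. \<forall>\<sigma>.
     poly d (aw_x q \<sigma>) * (aw_x q (\<sigma> + 1/2) - aw_x q (\<sigma> - 1/2)) =
       poly p (aw_x q (\<sigma> + 1/2)) - poly p (aw_x q (\<sigma> - 1/2)) \<and>
     poly s (aw_x q \<sigma>) = (poly p (aw_x q (\<sigma> + 1/2)) + poly p (aw_x q (\<sigma> - 1/2))) / 2"
proof (induction p)
  case 0
  show ?case by (rule exI[of _ 0], rule exI[of _ 0]) simp
next
  case (pCons a p)
  then obtain d s where
    d: "\<And>\<sigma>. poly d (aw_x q \<sigma>) * (aw_x q (\<sigma> + 1/2) - aw_x q (\<sigma> - 1/2)) =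
          poly p (aw_x q (\<sigma> + 1/2)) - poly p (aw_x q (\<sigma> - 1/2))" and
    s: "\<And>\<sigma>. poly s (aw_x q \<sigma>) = (poly p (aw_x q (\<sigma> + 1/2)) + poly p (aw_x q (\<sigma> - 1/2))) / 2"
    by blast
  let ?a = "[:0, complex_of_real (aw_alpha q):]"
  show ?case
  proof (intro exI allI conjI)
    fix \<sigma>
    define X where "X = aw_x q (\<sigma> + 1/2)"
    define Y where "Y = aw_x q (\<sigma> - 1/2)"
    define A where "A = poly p X"
    define B where "B = poly p Y"
    define E where "E = poly d (aw_x q \<sigma>)"
    have E: "E * (X - Y) = A - B" using d[of \<sigma>] by (simp add: E_def A_def B_def X_def Y_def)
    have S: "poly s (aw_x q \<sigma>) = (A + B) / 2" using s[of \<sigma>] by (simp add: A_def B_def X_def Y_def)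
    have a: "poly ?a (aw_x q \<sigma>) = (X + Y) / 2"
      using aw_x_sum[OF assms, of \<sigma>] by (simp add: X_def Y_def mult.commute)
    have U: "poly (aw_U2 q) (aw_x q \<sigma>) = ((X - Y) / 2)\<^sup>2"
      using aw_x_diff[OF assms, of \<sigma>] by (simp add: X_def Y_def)
    have "((A + B) / 2 + (X + Y) / 2 * E) * (X - Y) = (A + B) / 2 * (X - Y) + (X + Y) / 2 * (A - B)"
      unfolding E[symmetric] by (simp only: distrib_right mult.assoc)
    also have "\<dots> = (a + X * A) - (a + Y * B)" by (simp add: field_simps)
    finally show "poly (s + ?a * d) (aw_x q \<sigma>) * (aw_x q (\<sigma> + 1/2) - aw_x q (\<sigma> - 1/2)) =
        poly (pCons a p) (aw_x q (\<sigma> + 1/2)) - poly (pCons a p) (aw_x q (\<sigma> - 1/2))"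
      unfolding poly_add poly_mult S a unfolding poly_pCons
      by (simp add: X_def[symmetric] Y_def[symmetric] A_def[symmetric] B_def[symmetric]
          E_def[symmetric])
    have "a + ((X - Y) / 2)\<^sup>2 * E + (X + Y) / 2 * ((A + B) / 2)
        = a + (X - Y) / 4 * (E * (X - Y)) + (X + Y) / 2 * ((A + B) / 2)"
      by (simp add: power2_eq_square field_simps)
    also have "\<dots> = ((a + X * A) + (a + Y * B)) / 2"
      unfolding E by (simp add: field_simps)
    finally show "poly ([:a:] + aw_U2 q * d + ?a * s) (aw_x q \<sigma>) =
        (poly (pCons a p) (aw_x q (\<sigma> + 1/2)) + poly (pCons a p) (aw_x q (\<sigma> - 1/2))) / 2"
      unfolding poly_add poly_mult S a U unfolding poly_pCons
      by (simp add: X_def[symmetric] Y_def[symmetric] A_def[symmetric] B_def[symmetric]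
          E_def[symmetric])
  qed
qed

lemma aw_lattice_poly_eqI:
  assumes q: "0 < q" "q < 1"
    and eq: "\<And>\<sigma>. aw_x q (\<sigma> + 1/2) \<noteq> aw_x q (\<sigma> - 1/2) \<Longrightarrow> poly r (aw_x q \<sigma>) = poly r' (aw_x q \<sigma>)"
  shows "r = r'"
proof -
  define y where "y = (\<lambda>v::real. (q powr v + 1 / q powr v) / 2)"
  have xy: "aw_x q (of_real v) = of_real (y v)" for v
    using powr_of_real[of q v] q by (simp add: aw_x_def y_def powr_minus_divide)
  have mono: "y v < y w" if "0 \<le> v" "v < w" for v w
  proof -
    let ?a = "q powr v" and ?b = "q powr w"
    have ab: "0 < ?b" "?b < ?a" "?a \<le> 1"
      using q that powr_le1[of v q] by (auto intro: powr_less_mono')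
    then have "?a * ?b < 1"
      using mult_strict_mono[of ?a 1 ?b 1] mult_le_one[of ?a ?b]
      by (smt (verit) mult_left_le_one_le)
    then have "0 < (?a - ?b) * (1 - ?a * ?b) / (?a * ?b)" using ab by simp
    also have "\<dots> = (?b + 1 / ?b) - (?a + 1 / ?a)" using ab by (simp add: field_simps)
    finally show ?thesis by (simp add: y_def)
  qed
  have "inj_on (\<lambda>v. complex_of_real (y v)) {1<..}"
  proof (rule linorder_inj_onI')
    fix v w :: real assume "v \<in> {1<..}" "w \<in> {1<..}" "v < w"
    then have "y v < y w" by (intro mono) auto
    then show "complex_of_real (y v) \<noteq> of_real (y w)" by simp
  qed
  then have "infinite ((\<lambda>v. complex_of_real (y v)) ` {1<..})"
    using finite_imageD infinite_Ioi by blast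
  moreover have "(\<lambda>v. complex_of_real (y v)) ` {1<..} \<subseteq> {z. poly (r - r') z = 0}"
  proof (rule image_subsetI)
    fix v :: real assume "v \<in> {1<..}"
    then have "y (v - 1/2) < y (v + 1/2)" by (intro mono) auto
    then have "aw_x q (of_real v + 1/2) \<noteq> aw_x q (of_real v - 1/2)"
      using xy[of "v + 1/2"] xy[of "v - 1/2"] by simp
    from eq[OF this] show "of_real (y v) \<in> {z. poly (r - r') z = 0}" by (simp add: xy)
  qed
  ultimately have "infinite {z. poly (r - r') z = 0}" using infinite_super by blast
  then have "r - r' = 0" using poly_roots_finite by blast
  then show ?thesis by simp
qed

lemma ex1_aw_D:
  assumes "0 < q" "q < 1"
  shows "\<exists>!r. \<forall>\<sigma>. aw_x q (\<sigma> + 1/2) \<noteq> aw_x q (\<sigma> - 1/2) \<longrightarrow>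
     poly r (aw_x q \<sigma>) =
       (poly p (aw_x q (\<sigma> + 1/2)) - poly p (aw_x q (\<sigma> - 1/2))) /
       (aw_x q (\<sigma> + 1/2) - aw_x q (\<sigma> - 1/2))"
    (is "\<exists>!r. ?P r")
proof -
  obtain d where d: "\<And>\<sigma>. poly d (aw_x q \<sigma>) * (aw_x q (\<sigma> + 1/2) - aw_x q (\<sigma> - 1/2)) =
          poly p (aw_x q (\<sigma> + 1/2)) - poly p (aw_x q (\<sigma> - 1/2))"
    using aw_operators_exist[OF assms(1), of p] by blast
  show ?thesis
  proof (rule ex1I[of ?P d])
    show "?P d" using d by (simp add: eq_divide_eq)
    show "r = d" if "?P r" for r
      by (rule aw_lattice_poly_eqI[OF assms]) (use that \<open>?P d\<close> in auto)
  qed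
qed

lemma ex1_aw_S:
  assumes "0 < q" "q < 1"
  shows "\<exists>!r. \<forall>\<sigma>. poly r (aw_x q \<sigma>) =
     (poly p (aw_x q (\<sigma> + 1/2)) + poly p (aw_x q (\<sigma> - 1/2))) / 2"
    (is "\<exists>!r. ?P r")
proof -
  obtain s where s: "?P s"
    using aw_operators_exist[OF assms(1), of p] by blast
  show ?thesis
  proof (rule ex1I[of ?P s])
    show "?P s" by (fact s)
    show "r = s" if "?P r" for r
      by (rule aw_lattice_poly_eqI[OF assms]) (simp only: that s)
  qed
qed

lemmas aw_D_spec = theI'[OF ex1_aw_D, folded aw_D_def]
lemmas aw_S_spec = theI'[OF ex1_aw_S, folded aw_S_def]

end

theory Submission
  imports Defs
begin

text \<open>
  Put \<open>A = S\<^sub>q D\<^sub>q\<close> and \<open>c = 2 \<alpha>\<^sup>2 - 1 = (q + 1/q) / 2\<close>. The product rules for \<open>D\<^sub>q\<close> and \<open>S\<^sub>q\<close> give one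
  quadratic relation between \<open>A\<close> and multiplication by \<open>z\<close>:
  \<open>z\<^sup>2 A - 2 c z A z + A z\<^sup>2 + (c\<^sup>2 - 1) A + (c - 1) z = 0\<close>.

  If the functional equations hold, the first two say that \<open>u \<circ> A = L\<^sub>0 u\<close> and \<open>u \<circ> z A = L\<^sub>1 u\<close> with
  polynomials of degree 1 and 2. The relation then yields, for every polynomial \<open>g\<close>, a polynomial \<open>\<pi>\<close>
  of degree at most \<open>deg g + 1\<close> with \<open>u \<circ> g A = \<pi> u\<close>; hence \<open>A P\<^sub>n\<close> is orthogonal to all polynomials of
  degree less than \<open>n - 1\<close>.

  If \<open>A P\<^sub>n = k\<^sub>n P\<^bsub>n-1\<^esub>\<close>, apply the relation to \<open>P\<^sub>n\<close> and expand with the three-term recurrence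
  \<open>z P\<^sub>n = P\<^bsub>n+1\<^esub> + B\<^sub>n P\<^sub>n + C\<^sub>n P\<^bsub>n-1\<^esub>\<close>. The coefficients for \<open>n \<le> 3\<close> force \<open>B\<^sub>0 = 0\<close> and leave a quadratic
  equation for \<open>C\<^sub>1\<close> with the solutions \<open>(1 - p) / 2\<close>, \<open>p \<in> {q, 1/q}\<close>; this determines \<open>L\<^sub>0\<close> and \<open>L\<^sub>1\<close>.
\<close>

section \<open>Linearity of functionals\<close>

lemma poly_dual_add: "u \<in> poly_dual \<Longrightarrow> u (f + g) = u f + u g"
  and poly_dual_smult: "u \<in> poly_dual \<Longrightarrow> u (smult a f) = a * u f"
  and poly_dual_0: "u \<in> poly_dual \<Longrightarrow> u 0 = 0"
  and poly_dual_diff: "u \<in> poly_dual \<Longrightarrow> u (f - g) = u f - u g"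
  and poly_dual_minus: "u \<in> poly_dual \<Longrightarrow> u (- f) = - u f"
  unfolding poly_dual_def mem_Collect_eq
proof -
  assume "Vector_Spaces.linear smult (*) u"
  then interpret Vector_Spaces.linear smult "(*)" u .
  show "u (f + g) = u f + u g" "u (smult a f) = a * u f" "u 0 = 0" "u (f - g) = u f - u g" 
    "u (- f) = - u f"
    by (fact add scale zero diff neg)+
qed

abbreviation (input) Z :: "complex poly" where "Z \<equiv> [:0, 1:]"

section \<open>Commutation relations\<close>

locale aw_operators =
  fixes q :: real
  assumes q: "0 < q" "q < 1"
begin

abbreviation "S \<equiv> aw_S q"
abbreviation "D \<equiv> aw_D q"
abbreviation "A f \<equiv> S (D f)"
abbreviation \<alpha> :: complex where "\<alpha> \<equiv> of_real (aw_alpha q)"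
definition c :: complex where "c = 2 * \<alpha>\<^sup>2 - 1"

text \<open>With the denominator multiplied out, the identity holds at every \<sigma>: where the two
  nodes coincide, both sides vanish.\<close>

lemma D_spec:
  "poly (D p) (aw_x q \<sigma>) * (aw_x q (\<sigma> + 1/2) - aw_x q (\<sigma> - 1/2)) =
     poly p (aw_x q (\<sigma> + 1/2)) - poly p (aw_x q (\<sigma> - 1/2))"
  using aw_D_spec[OF q, of p, rule_format, of \<sigma>]
  by (cases "aw_x q (\<sigma> + 1/2) = aw_x q (\<sigma> - 1/2)") (simp_all add: field_simps)

lemma D_eqI:
  assumes "\<And>\<sigma>. poly r (aw_x q \<sigma>) * (aw_x q (\<sigma> + 1/2) - aw_x q (\<sigma> - 1/2)) =
     poly p (aw_x q (\<sigma> + 1/2)) - poly p (aw_x q (\<sigma> - 1/2))"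
  shows "D p = r"
proof (rule aw_lattice_poly_eqI[OF q])
  fix \<sigma> assume "aw_x q (\<sigma> + 1/2) \<noteq> aw_x q (\<sigma> - 1/2)"
  then show "poly (D p) (aw_x q \<sigma>) = poly r (aw_x q \<sigma>)"
    using assms[of \<sigma>] D_spec[of p \<sigma>] by (metis eq_iff_diff_eq_0 mult_right_cancel)
qed

lemmas S_spec = aw_S_spec[OF q, rule_format]

lemma S_eqI:
  assumes "\<And>\<sigma>. poly r (aw_x q \<sigma>) = (poly p (aw_x q (\<sigma> + 1/2)) + poly p (aw_x q (\<sigma> - 1/2))) / 2"
  shows "S p = r"
  by (rule aw_lattice_poly_eqI[OF q]) (simp only: assms S_spec)

lemma D_add: "D (f + g) = D f + D g"
  by (rule D_eqI) (simp add: distrib_right D_spec)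

lemma D_smult: "D (smult a f) = smult a (D f)"
  by (rule D_eqI) (simp only: poly_smult mult.assoc D_spec right_diff_distrib[symmetric])

lemma S_add: "S (f + g) = S f + S g"
  by (rule S_eqI) (simp add: S_spec add_divide_distrib)

lemma S_smult: "S (smult a f) = smult a (S f)"
  by (rule S_eqI) (simp add: S_spec distrib_left add_divide_distrib)

lemma D_const: "D [:a:] = 0"
  by (rule D_eqI) simp

lemma S_const: "S [:a:] = [:a:]"
  by (rule S_eqI) simp

lemma D_0: "D 0 = 0" and S_0: "S 0 = 0"
  using D_const[of 0] S_const[of 0] by simp_all

text \<open>Scalars are written as constant polynomial factors, so that operator identities become
  identities in a commutative ring, within reach of \<open>algebra\<close>.\<close>

lemma D_const_mult: "D ([:a:] * f) = [:a:] * D f"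
  using D_smult[of a f] by simp

lemma S_const_mult: "S ([:a:] * f) = [:a:] * S f"
  using S_smult[of a f] by simp

lemma D_diff: "D (f - g) = D f - D g"
  by (rule D_eqI) (simp add: left_diff_distrib D_spec)

lemma S_diff: "S (f - g) = S f - S g"
  by (rule S_eqI) (simp add: S_spec field_simps)

lemmas op_simps = D_0 S_0 D_add S_add D_const S_const D_const_mult S_const_mult D_diff S_diff

section \<open>Product rules and commutation with multiplication by z\<close>

lemma Z_mult_pCons: "pCons a f = [:a:] + Z * f"
  by simp

lemma poly_\<alpha>Z: "\<alpha> * aw_x q \<sigma> = (aw_x q (\<sigma> + 1/2) + aw_x q (\<sigma> - 1/2)) / 2"
  using aw_x_sum[OF q(1), of \<sigma>] by simp

text \<open>With X, Y the two shifted nodes, X f(X) - Y f(Y) is the mean of f times X - Y plus the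
  mean of the nodes times f(X) - f(Y). The mean of the nodes is
  \<open>\<alpha> * aw_x q \<sigma>\<close>.\<close>

lemma D_Z: "D (Z * f) = S f + [:\<alpha>:] * (Z * D f)"
proof (rule D_eqI)
  fix \<sigma>
  define X Y E where "X = aw_x q (\<sigma> + 1/2)" and "Y = aw_x q (\<sigma> - 1/2)" and "E = poly (D f) (aw_x q \<sigma>)"
  have E: "E * (X - Y) = poly f X - poly f Y"
    using D_spec[of f \<sigma>] by (simp add: X_def Y_def E_def)
  have "poly (S f + [:\<alpha>:] * (Z * D f)) (aw_x q \<sigma>) * (X - Y) 
      = ((poly f X + poly f Y) / 2 + \<alpha> * aw_x q \<sigma> * E) * (X - Y)"
    by (simp add: S_spec X_def Y_def E_def)
  also have "\<dots> = (poly f X + poly f Y) / 2 * (X - Y) + (X + Y) / 2 * (E * (X - Y))"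
    unfolding poly_\<alpha>Z by (simp add: algebra_simps X_def Y_def)
  also have "\<dots> = X * poly f X - Y * poly f Y"
    unfolding E by (simp add: field_simps)
  finally show "poly (S f + [:\<alpha>:] * (Z * D f)) (aw_x q \<sigma>) * (aw_x q (\<sigma> + 1/2) - aw_x q (\<sigma> - 1/2)) =
      poly (Z * f) (aw_x q (\<sigma> + 1/2)) - poly (Z * f) (aw_x q (\<sigma> - 1/2))"
    by (simp add: X_def Y_def)
qed

text \<open>The mean of X f(X) and Y f(Y) is the product of the two means plus (X - Y) (f(X) - f(Y))
  / 4. Since f(X) - f(Y) is \<open>D f\<close> times X - Y, the last term contains ((X - Y) / 2)^2,
  which is \<open>aw_U2 q\<close>.\<close>

lemma S_Z: "S (Z * f) = aw_U2 q * D f + [:\<alpha>:] * (Z * S f)"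
proof (rule S_eqI)
  fix \<sigma>
  define X Y E where "X = aw_x q (\<sigma> + 1/2)" and "Y = aw_x q (\<sigma> - 1/2)" and "E = poly (D f) (aw_x q \<sigma>)"
  have E: "E * (X - Y) = poly f X - poly f Y"
    using D_spec[of f \<sigma>] by (simp add: X_def Y_def E_def)
  have "poly (aw_U2 q * D f + [:\<alpha>:] * (Z * S f)) (aw_x q \<sigma>)
      = ((X - Y) / 2)\<^sup>2 * E + \<alpha> * aw_x q \<sigma> * ((poly f X + poly f Y) / 2)"
    by (simp add: S_spec X_def Y_def E_def aw_x_diff[OF q(1)])
  also have "\<dots> = (X - Y) / 4 * (E * (X - Y)) + (X + Y) / 2 * ((poly f X + poly f Y) / 2)"
    unfolding poly_\<alpha>Z by (simp add: field_simps power2_eq_square X_def Y_def)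
  also have "\<dots> = (X * poly f X + Y * poly f Y) / 2"
    unfolding E by (simp add: field_simps)
  finally show "poly (aw_U2 q * D f + [:\<alpha>:] * (Z * S f)) (aw_x q \<sigma>) =
      (poly (Z * f) (aw_x q (\<sigma> + 1/2)) + poly (Z * f) (aw_x q (\<sigma> - 1/2))) / 2"
    by (simp add: X_def Y_def)
qed

lemma U2_eq: "aw_U2 q = [:\<alpha>\<^sup>2 - 1:] * (Z * Z - 1)"
  by (simp add: aw_U2_def one_pCons)

lemma const_poly: "[:\<alpha>\<^sup>2 - 1:] = [:\<alpha>:]\<^sup>2 - 1" "[:c:] = 2 * [:\<alpha>:]\<^sup>2 - 1"
  by (simp_all add: power2_eq_square c_def one_pCons numeral_poly)

text \<open>The product rules applied to a + z f mix \<open>D (S f)\<close> with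
  \<open>S (S f)\<close>, so both formulas go through one induction.\<close>

lemma DS_SS:
  "D (S f) = [:\<alpha>:] * A f + [:\<alpha>\<^sup>2 - 1:] * (Z * D (D f)) \<and>
   S (S f) = [:\<alpha>\<^sup>2 - 1:] * (Z * A f) + [:\<alpha>:] * (aw_U2 q * D (D f)) + f"
proof (induction f)
  case 0
  then show ?case using D_const[of 0] S_const[of 0] by simp
next
  case (pCons a f)
  show ?case
    unfolding Z_mult_pCons[of a f] U2_eq distrib_left distrib_right mult.assoc left_diff_distrib right_diff_distrib
      mult_1_left mult_1_right
      op_simps D_Z S_Z pCons.IH[THEN conjunct1] pCons.IH[THEN conjunct2]
    unfolding const_poly by (intro conjI) algebra+
qed

abbreviation "\<beta> \<equiv> \<alpha>\<^sup>2 - 1"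

lemma DS: "D (S f) = [:\<alpha>:] * A f + [:\<beta>:] * (Z * D (D f))"
  and SS: "S (S f) = [:\<beta>:] * (Z * A f) + [:\<alpha>:] * (aw_U2 q * D (D f)) + f"
  using DS_SS by blast+

lemma A_Z: "A (Z * f) = [:c:] * (Z * A f) + 2 * [:\<alpha>:] * (aw_U2 q * D (D f)) + f"
  unfolding D_Z op_simps S_Z DS SS const_poly by algebra

lemma B_Z: "D (D (Z * f)) = [:c:] * (Z * D (D f)) + 2 * [:\<alpha>:] * A f"
  unfolding D_Z op_simps S_Z DS SS const_poly by algebra

text \<open>By \<open>A_Z\<close> and \<open>B_Z\<close>, commuting z past \<open>A\<close> and past
  the square of \<open>D\<close> produces only these two operators again. Applying
  \<open>A_Z\<close> twice and eliminating the square of \<open>D\<close> leaves a relation in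
  \<open>A\<close> alone; the coefficients combine through 4 \<alpha>^2 (\<alpha>^2 - 1) = c^2 -
  1.\<close>

lemma A_relation:
  "Z * (Z * A f) - 2 * [:c:] * (Z * A (Z * f)) + A (Z * (Z * f)) + ([:c:]\<^sup>2 - 1) * A f + ([:c:] - 1) * (Z * f) = 0"
  unfolding A_Z B_Z U2_eq const_poly by algebra

text \<open>Both bounds pass from f to a + z f together, by the product rules. The alternative
  \<open>D f = 0\<close> covers constants, whose degree cannot drop further.\<close>

lemma degree_DS:
  "(D f = 0 \<or> degree (D f) < degree f) \<and> degree (S f) \<le> degree f"
proof (induction f)
  case 0
  then show ?case using D_const[of 0] S_const[of 0] by simp
next
  case (pCons a f)
  show ?case
  proof (cases "f = 0")
    case True
    then show ?thesis using D_const[of a] S_const[of a] by simp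
  next
    case False
    let ?n = "degree f"
    have Dn: "degree (D f) \<le> ?n - 1" and D0: "?n = 0 \<Longrightarrow> D f = 0" and Sn: "degree (S f) \<le> ?n"
      using pCons.IH by auto
    have "D (pCons a f) = S f + [:\<alpha>:] * (Z * D f)"
      unfolding Z_mult_pCons[of a f] op_simps D_Z by simp
    moreover have "degree ([:\<alpha>:] * (Z * D f)) \<le> ?n"
    proof (cases "?n = 0")
      case False
      have "degree ([:\<alpha>:] * (Z * D f)) \<le> degree (Z * D f)" by simp
      also have "\<dots> \<le> 1 + degree (D f)" using degree_mult_le[of Z "D f"] by simp
      finally show ?thesis using Dn False by simp
    qed (use D0 in simp)
    ultimately have "degree (D (pCons a f)) \<le> ?n"
      using Sn by (simp only: degree_add_le)
    moreover have "S (pCons a f) = [:a:] + (aw_U2 q * D f + [:\<alpha>:] * (Z * S f))"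
      unfolding Z_mult_pCons[of a f] op_simps S_Z by simp
    moreover have "degree (aw_U2 q * D f) \<le> Suc ?n"
    proof (cases "?n = 0")
      case False
      have "degree (aw_U2 q) \<le> 2" by (simp add: aw_U2_def)
      then show ?thesis using degree_mult_le[of "aw_U2 q" "D f"] Dn False by linarith
    qed (use D0 in simp)
    moreover have "degree ([:\<alpha>:] * (Z * S f)) \<le> Suc ?n"
    proof -
      have "degree ([:\<alpha>:] * (Z * S f)) \<le> degree (Z * S f)" by simp
      also have "\<dots> \<le> 1 + degree (S f)" using degree_mult_le[of Z "S f"] by simp
      finally show ?thesis using Sn by simp
    qed
    ultimately show ?thesis using False by (auto intro!: degree_add_le)
  qed
qed

lemma degree_A: "A f = 0 \<or> degree (A f) < degree f"
  using degree_DS[of f] degree_DS[of "D f"] S_const[of 0] by force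

lemma c_eq: "c = of_real ((q + 1 / q) / 2)"
proof -
  have "q powr (1/2) * q powr (1/2) = q" "q powr (-1/2) * q powr (-1/2) = 1 / q"
    "q powr (1/2) * q powr (-1/2) = 1"
    using q by (simp_all add: powr_add[symmetric] powr_minus_divide)
  then have "2 * (aw_alpha q)\<^sup>2 - 1 = (q + 1 / q) / 2"
    unfolding aw_alpha_def power2_eq_square by (simp add: algebra_simps add_divide_distrib)
  then show ?thesis unfolding c_def by (metis of_real_1 of_real_diff of_real_mult of_real_numeral of_real_power)
qed

lemma c_gt: "1 < (q + 1 / q) / 2"
proof -
  have "0 < (1 - q)\<^sup>2 / q" using q by simp
  also have "\<dots> = q + 1 / q - 2" using q by (simp add: power2_eq_square field_simps)
  finally show ?thesis by simp
qed

end

section \<open>Monic orthogonal polynomials\<close>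

locale monic_orthogonal =
  fixes u :: "complex poly \<Rightarrow> complex" and P :: "nat \<Rightarrow> complex poly" and h :: "nat \<Rightarrow> complex"
  assumes u: "u \<in> poly_dual"
    and degree_P: "degree (P n) = n" and lead_P: "lead_coeff (P n) = 1"
    and h_nonzero: "h n \<noteq> 0"
    and u_P_P: "u (P j * P n) = (if j = n then h n else 0)"
begin

lemmas u_simps = poly_dual_add[OF u] poly_dual_smult[OF u] poly_dual_diff[OF u] poly_dual_0[OF u] poly_dual_minus[OF u]

section \<open>Expansion in the orthogonal basis\<close>

lemma P_0: "P 0 = 1"
proof -
  obtain a where "P 0 = [:a:]" using degree_P[of 0] degree_eq_zeroE by blast
  then show ?thesis using lead_P[of 0] by (simp add: one_pCons)
qed

lemma degree_reduce:
  assumes "f \<noteq> 0"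
  shows "f - smult (lead_coeff f) (P (degree f)) = 0 \<or>
    degree (f - smult (lead_coeff f) (P (degree f))) < degree f"
proof -
  let ?g = "f - smult (lead_coeff f) (P (degree f))"
  have "degree ?g \<le> degree f"
    using degree_diff_le[of f "degree f" "smult (lead_coeff f) (P (degree f))"] degree_P by simp
  moreover have "coeff ?g (degree f) = 0"
    using lead_P[of "degree f"] degree_P[of "degree f"] by simp
  ultimately show ?thesis
    by (metis le_neq_implies_less leading_coeff_0_iff)
qed

text \<open>Subtracting the leading coefficient times \<open>P (degree f)\<close> lowers the degree,
  so every polynomial is built from 0 by adding multiples of basis elements in increasing
  degree.\<close>

lemma P_induct:
  assumes "Q 0" and "\<And>f a n. Q f \<Longrightarrow> (f = 0 \<or> degree f < n) \<Longrightarrow> Q (f + smult a (P n))"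
  shows "Q f"
proof (induction "degree f" arbitrary: f rule: less_induct)
  case less
  show ?case
  proof (cases "f = 0")
    case False
    let ?g = "f - smult (lead_coeff f) (P (degree f))"
    have "Q ?g"
      using degree_reduce[OF False] less[of ?g] assms(1) by auto
    from assms(2)[OF this degree_reduce[OF False], of "lead_coeff f"] show ?thesis by simp
  qed (use assms in simp)
qed

lemma functional_eqI:
  assumes "v 0 = w 0"
    and "\<And>f a n. v (f + smult a (P n)) = v f + a * v (P n)"
    and "\<And>f a n. w (f + smult a (P n)) = w f + a * w (P n)"
    and "\<And>n. v (P n) = w (P n)"
  shows "v f = w f"
  by (induction f rule: P_induct) (simp_all add: assms)

lemma u_P_lower: "degree f < n \<Longrightarrow> u (P n * f) = 0"
proof (induction "degree f" arbitrary: f rule: less_induct)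
  case less
  show ?case
  proof (cases "f = 0")
    case False
    let ?g = "f - smult (lead_coeff f) (P (degree f))"
    have "u (P n * ?g) = 0"
      using degree_reduce[OF False] less(1)[of ?g] less(2) by (auto simp: u_simps)
    then show ?thesis using less(2) by (simp add: right_diff_distrib u_simps u_P_P)
  qed (simp add: u_simps)
qed

lemma u_P_degree: "u (P (degree f) * f) = lead_coeff f * h (degree f)"
proof (cases "f = 0")
  case False
  let ?g = "f - smult (lead_coeff f) (P (degree f))"
  have "u (P (degree f) * ?g) = 0"
    using degree_reduce[OF False] u_P_lower[of ?g "degree f"] by (auto simp: u_simps)
  then show ?thesis by (simp add: right_diff_distrib u_simps u_P_P)
qed (simp add: u_simps)

text \<open>A nonzero f pairs with \<open>P (degree f)\<close> to its leading coefficient times a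
  nonzero \<open>h\<close>. Polynomial identities are proved below by testing against the basis up
  to the degree.\<close>

lemma eq_0_if_orthogonal:
  assumes "degree f \<le> n" "\<And>j. j \<le> n \<Longrightarrow> u (P j * f) = 0"
  shows "f = 0"
  using u_P_degree[of f] assms h_nonzero by auto

section \<open>Three-term recurrence\<close>

definition B :: "nat \<Rightarrow> complex" where "B n = u (Z * P n * P n) / h n"
text \<open>The value 0 at n = 0 removes the term with \<open>P (n - 1)\<close>, which truncated
  subtraction would turn into \<open>P 0\<close>.\<close>

definition C :: "nat \<Rightarrow> complex" where "C n = (if n = 0 then 0 else h n / h (n - 1))"

text \<open>The difference of the two sides has degree at most n, and multiplication by z is
  symmetric for the pairing, so only the indices n and n - 1 need correction terms.\<close>

lemma recurrence: "Z * P n = P (Suc n) + smult (B n) (P n) + smult (C n) (P (n - 1))"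
proof -
  let ?f = "Z * P n - P (Suc n) - smult (B n) (P n) - smult (C n) (P (n - 1))"
  have P_nz: "P n \<noteq> 0" for n using lead_P[of n] by auto
  have degree_Z_P: "degree (Z * P n) = Suc n" for n
    using degree_mult_eq[of Z "P n"] P_nz[of n] by (simp add: degree_P)
  have lead_Z_P: "lead_coeff (Z * P n) = 1" for n
    unfolding lead_coeff_mult lead_P by simp
  have "degree (Z * P n - P (Suc n)) \<le> n"
  proof -
    have "Z * P n \<noteq> 0" using P_nz by simp
    from degree_reduce[OF this, unfolded lead_Z_P] show ?thesis
      unfolding degree_Z_P smult_1_left by (metis degree_0 le0 less_Suc_eq_le)
  qed
  then have "degree ?f \<le> n"
    using degree_smult_le[of "B n" "P n"] degree_smult_le[of "C n" "P (n - 1)"]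
    unfolding degree_P by - (rule degree_diff_le, rule degree_diff_le, linarith+)
  moreover have "u (P j * ?f) = 0" if jn: "j \<le> n" for j
  proof -
    have "u (P j * ?f) = u (P j * (Z * P n)) - u (P j * P (Suc n)) - B n * u (P j * P n) - C n * u (P j * P (n - 1))"
      by (simp only: right_diff_distrib u_simps mult_smult_right)
    moreover have "u (P j * P (Suc n)) = 0" using that by (simp add: u_P_P)
    moreover have "P j * (Z * P n) = P n * (Z * P j)" by (simp only: ac_simps)
    ultimately have e: "u (P j * ?f) = u (P n * (Z * P j)) - B n * u (P j * P n) - C n * u (P j * P (n - 1))"
      by (simp only: diff_0_right)
    consider "j = n" | "Suc j = n" | "Suc j < n" using jn by linarith
    then show ?thesis
    proof cases
      case 1
      have "P n * (Z * P n) = Z * P n * P n" by (simp only: ac_simps)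
      then have "u (P n * (Z * P j)) = B n * h n" using 1 h_nonzero[of n] by (simp only: B_def) simp
      moreover have "u (P j * P n) = h n" "C n * u (P j * P (n - 1)) = 0"
        using 1 by (auto simp: u_P_P C_def)
      ultimately show ?thesis unfolding e by (simp only: diff_self diff_0_right mult_zero_right)
    next
      case 2
      have "u (P n * (Z * P j)) = h n"
        using u_P_degree[of "Z * P j"] 2 unfolding lead_Z_P unfolding degree_Z_P by simp
      moreover have "u (P j * P n) = 0" "C n * u (P j * P (n - 1)) = h n"
        using 2 h_nonzero[of j] by (auto simp: u_P_P C_def)
      ultimately show ?thesis unfolding e by (simp only: diff_self diff_0_right mult_zero_right)
    next
      case 3
      have "u (P n * (Z * P j)) = 0"
        by (rule u_P_lower) (unfold degree_Z_P, fact)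
      moreover have "u (P j * P n) = 0" "u (P j * P (n - 1)) = 0"
        using 3 by (auto simp: u_P_P)
      ultimately show ?thesis unfolding e by (simp only: diff_self diff_0_right mult_zero_right)
    qed
  qed
  ultimately have "?f = 0" by (rule eq_0_if_orthogonal)
  then show ?thesis by (simp only: diff_eq_eq add_0_left ac_simps)
qed

end

section \<open>The functional equations imply the lowering relation\<close>

lemma const_hom:
  fixes a b :: "'a::comm_ring_1"
  shows "[:a + b:] = [:a:] + [:b:]" "[:a - b:] = [:a:] - [:b:]" "[:a * b:] = [:a:] * [:b:]"
    "[:a\<^sup>2:] = [:a:]\<^sup>2" "[:1 :: 'a:] = 1" "[:2::'a:] = 2"
  by (simp_all add: one_pCons numeral_poly power2_eq_square)

locale aw_functional = aw_operators q + monic_orthogonal u P h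
  for q u P h
begin

text \<open>c is real and exceeds 1; these are the factors cancelled in the eliminations
  below.\<close>

lemma c_nonzero: "c \<noteq> 0" "c \<noteq> 1" "c + 1 \<noteq> 0" "2 * c + 1 \<noteq> 0"
proof -
  have *: "(q + 1 / q) / 2 \<noteq> 0" "(q + 1 / q) / 2 \<noteq> 1" "(q + 1 / q) / 2 + 1 \<noteq> 0" "2 * ((q + 1 / q) / 2) + 1 \<noteq> 0"
    using c_gt by linarith+
  show "c \<noteq> 0" "c \<noteq> 1" "c + 1 \<noteq> 0" "2 * c + 1 \<noteq> 0"
    unfolding c_eq using *[folded of_real_eq_iff[where 'a = complex]]
    by (simp_all only: of_real_add of_real_mult of_real_numeral of_real_0 of_real_1 not_False_eq_True)
qed

lemma u_const: "u ([:a:] * f) = a * u f"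
  using poly_dual_smult[OF u, of a f] by simp

text \<open>\<open>A_relation\<close> multiplied by g and paired with u: it trades the weight z^2 g
  for the weights z g and g, at the price of factors z inside the argument of
  \<open>A\<close>.\<close>

lemma u_relation:
  "u (Z * (Z * g) * A f) =
     2 * c * u (Z * g * A (Z * f)) - u (g * A (Z * (Z * f))) - (c\<^sup>2 - 1) * u (g * A f)
     - (c - 1) * u (g * (Z * f))"
proof -
  have "Z * (Z * g) * A f = [:2 * c:] * (Z * g * A (Z * f)) - g * A (Z * (Z * f))
      - [:c\<^sup>2 - 1:] * (g * A f) - [:c - 1:] * (g * (Z * f))"
    using A_relation[of f] unfolding const_hom by algebra
  then show ?thesis by (simp only: u_simps u_const)
qed

text \<open>Writing g = a + b z + z^2 g2, \<open>u_relation\<close> reduces the last term to weights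
  of degree one and two less than n, while \<open>L0\<close> and \<open>L1\<close> handle a + b z.
  Each factor z moved into the argument ends up in \<pi>, which keeps the degree at most one above
  that of the weight.\<close>

lemma u_A_shift: 
  assumes L0: "degree L0 \<le> 1" "\<And>f. u (A f) = u (L0 * f)"
    and L1: "degree L1 \<le> 2" "\<And>f. u (Z * A f) = u (L1 * f)"
  shows "degree g \<le> n \<Longrightarrow> \<exists>\<pi>. degree \<pi> \<le> Suc n \<and> (\<forall>f. u (g * A f) = u (\<pi> * f))"
proof (induction n arbitrary: g rule: less_induct)
  case (less n)
  consider "n = 0" | "n = 1" | m where "n = m + 2"
    by (metis One_nat_def Suc_1 add_2_eq_Suc' not0_implies_Suc)
  then show ?case
  proof cases
    case 1
    then obtain a where g: "g = [:a:]" using less.prems degree_eq_zeroE by blast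
    show ?thesis
      using L0 1 by (intro exI[of _ "[:a:] * L0"]) (simp add: g u_simps)
  next
    case 2
    obtain a g' where g: "g = pCons a g'" by (cases g)
    have "degree g' = 0" using less.prems 2 by (cases "g' = 0") (simp_all add: g)
    then obtain b where "g' = [:b:]" using degree_eq_zeroE by blast
    then have g: "g = [:a:] + [:b:] * Z" by (simp add: g)
    have "u (g * A f) = u ((smult a L0 + smult b L1) * f)" for f
    proof -
      have "g * A f = [:a:] * A f + [:b:] * (Z * A f)"
        "(smult a L0 + smult b L1) * f = [:a:] * (L0 * f) + [:b:] * (L1 * f)"
        unfolding g by (simp_all add: algebra_simps)
      then show ?thesis by (simp only: u_simps u_const L0(2) L1(2))
    qed
    moreover have "degree (smult a L0 + smult b L1) \<le> Suc n"
      using L0(1) L1(1) 2 degree_smult_le[of a L0] degree_smult_le[of b L1]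
      by (intro degree_add_le) linarith+
    ultimately show ?thesis by blast
  next
    case (3 m)
    obtain a g1 where g1: "g = pCons a g1" by (cases g)
    obtain b g2 where g2: "g1 = pCons b g2" by (cases g1)
    have d1: "degree g1 \<le> Suc m" using less.prems 3 by (cases "g1 = 0") (simp_all add: g1)
    then have d2: "degree g2 \<le> m" by (cases "g2 = 0") (simp_all add: g2)
    then have dZ: "degree (Z * g2) \<le> Suc m" using degree_mult_le[of Z g2] by simp
    obtain p0 where p0: "degree p0 \<le> Suc m" "\<And>f. u (g2 * A f) = u (p0 * f)"
      using less.IH[OF _ d2] 3 by auto
    obtain p1 where p1: "degree p1 \<le> m + 2" "\<And>f. u (Z * g2 * A f) = u (p1 * f)"
      using less.IH[OF _ dZ] 3 by auto
    let ?\<pi> = "[:a:] * L0 + [:b:] * L1 + [:2 * c:] * (Z * p1) - (Z * Z + [:c\<^sup>2 - 1:]) * p0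
      - [:c - 1:] * (Z * g2)"
    have dc: "degree ([:x:] * f) \<le> degree f" for x :: complex and f
      by simp
    have dZ': "degree (Z * f) \<le> Suc (degree f)" for f
      using degree_mult_le[of Z f] by simp
    have "degree ([:a:] * L0) \<le> Suc n" "degree ([:b:] * L1) \<le> Suc n"
      using L0(1) L1(1) 3 dc[of a L0] dc[of b L1] by linarith+
    moreover have "degree ([:2 * c:] * (Z * p1)) \<le> Suc n"
      using dc[of "2 * c" "Z * p1"] dZ'[of p1] p1(1) 3 by linarith
    moreover have "degree ((Z * Z + [:c\<^sup>2 - 1:]) * p0) \<le> Suc n"
      using degree_mult_le[of "Z * Z + [:c\<^sup>2 - 1:]" p0] p0(1) 3 by simp
    moreover have "degree ([:c - 1:] * (Z * g2)) \<le> Suc n"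
      using dc[of "c - 1" "Z * g2"] dZ 3 by linarith
    ultimately have "degree ?\<pi> \<le> Suc n" by (intro degree_add_le degree_diff_le)
    moreover have "u (g * A f) = u (?\<pi> * f)" for f
    proof -
      have "g = [:a:] + Z * ([:b:] + Z * g2)" by (simp add: g1 g2)
      then have g: "g * A f = [:a:] * A f + [:b:] * (Z * A f) + Z * (Z * g2) * A f"
        by algebra
      have "?\<pi> * f = [:a:] * (L0 * f) + [:b:] * (L1 * f) + [:2 * c:] * (p1 * (Z * f)) - p0 * (Z * (Z * f))
          - [:c\<^sup>2 - 1:] * (p0 * f) - [:c - 1:] * (g2 * (Z * f))"
        by algebra
      then show ?thesis
        unfolding g by (simp only: u_simps u_const u_relation p0(2) p1(2) L0(2) L1(2)) algebra
    qed
    ultimately show ?thesis by blast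
  qed
qed

text \<open>\<open>A (P n)\<close> has degree below n, and by \<open>u_A_shift\<close> its pairing
  with \<open>P j\<close> is that of \<open>P n\<close> with a polynomial of degree at most j + 1,
  hence 0 for j + 1 < n. Only the component along \<open>P (n - 1)\<close> survives.\<close>

lemma lowering_if_functional:
  assumes L0: "degree L0 \<le> 1" "\<And>f. u (A f) = u (L0 * f)"
    and L1: "degree L1 \<le> 2" "\<And>f. u (Z * A f) = u (L1 * f)"
  shows "\<exists>k. \<forall>n. A (P n) = smult (k n) (if n = 0 then 0 else P (n - 1))"
proof -
  have "\<exists>k. A (P n) = smult k (if n = 0 then 0 else P (n - 1))" for n
  proof (cases n)
    case 0
    then show ?thesis using D_const[of 1] by (simp add: P_0 one_pCons S_0)
  next
    case (Suc m)
    define k where "k = u (P m * A (P n)) / h m"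
    let ?f = "A (P n) - smult k (P m)"
    have "degree (A (P n)) \<le> m"
      using degree_A[of "P n"] by (auto simp: degree_P Suc)
    then have "degree ?f \<le> m"
      using degree_smult_le[of k "P m"] by (intro degree_diff_le) (simp_all only: degree_P)
    moreover have "u (P j * ?f) = 0" if "j \<le> m" for j
    proof (cases "j = m")
      case True
      then show ?thesis using h_nonzero[of m] 
        by (simp add: right_diff_distrib u_simps u_P_P k_def)
    next
      case False
      have "degree (P j) \<le> j" by (simp add: degree_P)
      from u_A_shift[OF L0 L1 this] obtain \<pi>
        where \<pi>: "degree \<pi> \<le> Suc j" "\<And>f. u (P j * A f) = u (\<pi> * f)" by blast
      have "u (P n * \<pi>) = 0" using \<pi>(1) False that Suc by (intro u_P_lower) simp
      then show ?thesis using False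
        by (simp add: right_diff_distrib u_simps u_P_P \<pi>(2) mult.commute)
    qed
    ultimately have "?f = 0" by (rule eq_0_if_orthogonal)
    then show ?thesis using Suc by auto
  qed
  then show ?thesis by metis
qed

text \<open>These eliminate the square of \<open>D\<close> in favour of \<open>A\<close>, by solving
  \<open>A_Z\<close> for its middle term.\<close>

lemma u_Z_A_Z:
  "2 * \<alpha> * u (aw_U2 q * D (D f)) = u (A (Z * f)) - c * u (Z * A f) - u f"
  and u_Z_Z_A_Z: "2 * \<alpha> * u (Z * (aw_U2 q * D (D f))) = u (Z * A (Z * f)) - c * u (Z * (Z * A f)) - u (Z * f)"
proof -
  have "[:2 * \<alpha>:] * (aw_U2 q * D (D f)) = A (Z * f) - [:c:] * (Z * A f) - f"
    unfolding A_Z unfolding const_hom by algebra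
  then show "2 * \<alpha> * u (aw_U2 q * D (D f)) = u (A (Z * f)) - c * u (Z * A f) - u f"
    by (metis u_const u_simps(3))
  have "[:2 * \<alpha>:] * (Z * (aw_U2 q * D (D f))) = Z * A (Z * f) - [:c:] * (Z * (Z * A f)) - Z * f"
    unfolding A_Z unfolding const_hom by algebra
  then show "2 * \<alpha> * u (Z * (aw_U2 q * D (D f))) = u (Z * A (Z * f)) - c * u (Z * (Z * A f)) - u (Z * f)"
    by (metis u_const u_simps(3))
qed

text \<open>
  The first two functional equations, solved for \<open>u \<circ> A\<close> and \<open>u \<circ> z A\<close>, with \<open>p = q\<^sup>s\<close>. The orthogonal
  polynomials are the Al-Salam--Chihara polynomials with parameters \<open>1, -1\<close> and base \<open>p\<close>.
\<close>

definition al_salam_chihara :: "complex \<Rightarrow> bool" where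
  "al_salam_chihara p \<longleftrightarrow> (\<forall>f. (1 - p) * u (A f) = 2 * u (Z * f) \<and>
     p * (1 - p) * u (Z * A f) = 2 * u (Z * (Z * f)) - (1 - p) * u f)"

text \<open>Here \<rho> stands for q^(s/2); since \<alpha> is invariant under \<rho> -> 1/\<rho>,
  both signs of s are treated at once. The first equation is one half of
  \<open>al_salam_chihara\<close>; given it, the second is equivalent to the other half. The third
  and fourth then follow.\<close>

lemma functional_equations_iff:
  fixes \<rho> :: complex
  assumes \<rho>: "\<rho> \<noteq> 0" "\<rho>\<^sup>2 \<noteq> 1" "\<rho>\<^sup>2 \<noteq> - 1" and \<alpha>: "2 * \<alpha> = \<rho> + 1 / \<rho>"
  defines "p \<equiv> \<rho>\<^sup>2"
  shows "al_salam_chihara p \<longleftrightarrow>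
     dual_scale (p - 1) (dual_D q (dual_S q u)) = dual_mult [:0, 2:] u
   \<and> dual_scale (2 * \<rho> ^ 3) (dual_D q (dual_D q (dual_mult (aw_U2 q) u))) = dual_mult (- [:p - 1, 0, 2:]) u
   \<and> dual_scale (2 * p) (dual_S q (dual_S q u)) = dual_mult [:1 + p, 0, -2:] u
   \<and> dual_scale (8 * \<rho> ^ 5) (dual_S q (dual_D q (dual_mult (aw_U2 q) u)))
       = dual_mult (smult (1 - p) ([:0, 1:] * [:p\<^sup>2 + 3, 0, -4:])) u"
    (is "_ \<longleftrightarrow> ?E1 \<and> ?E2 \<and> ?E3 \<and> ?E4")
proof -
  have lin: "u ([:0, 2:] * f) = 2 * u (Z * f)" for f
  proof -
    have "[:0, 2:] * f = [:2:] * (Z * f)" by simp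
    then show ?thesis by (simp only: u_const)
  qed
  have quad: "u ([:a, 0, b:] * f) = a * u f + b * u (Z * (Z * f))" for a b f
  proof -
    have "[:a, 0, b:] * f = [:a:] * f + [:b:] * (Z * (Z * f))" by (simp add: algebra_simps)
    then show ?thesis by (simp only: u_const u_simps)
  qed
  have cub: "u (smult (1 - p) ([:0, 1:] * [:p\<^sup>2 + 3, 0, -4:]) * f) 
      = (1 - p) * ((p\<^sup>2 + 3) * u (Z * f) - 4 * u (Z * (Z * (Z * f))))" for f
  proof -
    have e: "smult (1 - p) ([:0, 1:] * [:p\<^sup>2 + 3, 0, -4:]) * f = smult (1 - p) ([:p\<^sup>2 + 3, 0, -4:] * (Z * f))"
      by (simp only: mult_smult_left mult_smult_right ac_simps)
    show ?thesis unfolding e quad u_simps by simp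
  qed
  have \<alpha>': "\<alpha> * (2 * \<rho>) = p + 1" and c': "c * (2 * p) = p\<^sup>2 + 1"
  proof -
    show *: "\<alpha> * (2 * \<rho>) = p + 1"
      using \<alpha> \<rho>(1) unfolding p_def by (simp add: field_simps power2_eq_square)
    have "c * (2 * p) = (\<alpha> * (2 * \<rho>))\<^sup>2 - 2 * p" unfolding c_def p_def by algebra
    then show "c * (2 * p) = p\<^sup>2 + 1" unfolding * by algebra
  qed
  have nz: "p \<noteq> 0" "1 - p \<noteq> 0" "p + 1 \<noteq> 0"
    using \<rho> unfolding p_def by (auto simp: eq_neg_iff_add_eq_0)
  have E1: "?E1 \<longleftrightarrow> (\<forall>f. (1 - p) * u (A f) = 2 * u (Z * f))"
    unfolding dual_scale_def dual_D_def dual_S_def dual_mult_def fun_eq_iff lin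
    by (simp add: algebra_simps)
  have E2: "?E2 \<longleftrightarrow> (\<forall>f. 2 * \<rho> ^ 3 * u (aw_U2 q * D (D f)) = (1 - p) * u f - 2 * u (Z * (Z * f)))"
    unfolding dual_scale_def dual_D_def dual_S_def dual_mult_def fun_eq_iff mult_minus_left u_simps quad
    by (simp add: algebra_simps)
  have E3: "?E3 \<longleftrightarrow> (\<forall>f. 2 * p * u (S (S f)) = (1 + p) * u f - 2 * u (Z * (Z * f)))"
    unfolding dual_scale_def dual_D_def dual_S_def dual_mult_def fun_eq_iff quad
    by (simp add: algebra_simps)
  have E4: "?E4 \<longleftrightarrow> (\<forall>f. - 8 * \<rho> ^ 5 * u (aw_U2 q * D (S f))
      = (1 - p) * ((p\<^sup>2 + 3) * u (Z * f) - 4 * u (Z * (Z * (Z * f)))))"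
    unfolding dual_scale_def dual_D_def dual_S_def dual_mult_def fun_eq_iff cub
    by simp
  have E2': "2 * \<rho> ^ 3 * u (aw_U2 q * D (D f)) = (1 - p) * u f - 2 * u (Z * (Z * f)) \<longleftrightarrow>
      p * (1 - p) * u (Z * A f) = 2 * u (Z * (Z * f)) - (1 - p) * u f"
    if L0: "\<And>f. (1 - p) * u (A f) = 2 * u (Z * f)" for f
  proof -
    define b where "b = u (aw_U2 q * D (D f))"
    define l where "l = u (Z * A f)"
    define m0 m2 where "m0 = u f" and "m2 = u (Z * (Z * f))"
    have "(1 - p) * (2 * \<alpha> * b) = 2 * m2 - (1 - p) * c * l - (1 - p) * m0"
      unfolding b_def l_def m0_def m2_def u_Z_A_Z using L0[of "Z * f"] by algebra
    \<comment> \<open>The defects of the two equations are proportional; both factors are nonzero,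
      the first because 1 + p^2 = 2 c p.\<close>
    then have "(1 + p\<^sup>2) * (p * (1 - p) * l - (2 * m2 - (1 - p) * m0)) 
        = - ((1 - p\<^sup>2) * (2 * \<rho> ^ 3 * b - ((1 - p) * m0 - 2 * m2)))"
      using \<alpha>' c' p_def by algebra
    moreover have "1 + p\<^sup>2 \<noteq> 0"
      by (metis add.commute c' c_nonzero(1) mult_eq_0_iff nz(1) zero_neq_numeral)
    moreover have "1 - p\<^sup>2 \<noteq> 0"
      using nz by (simp add: power2_eq_square square_eq_1_iff eq_neg_iff_add_eq_0)
    ultimately show ?thesis unfolding b_def[symmetric] l_def[symmetric] m0_def[symmetric] m2_def[symmetric]
      by (metis diff_eq_eq add_0 mult_eq_0_iff neg_equal_0_iff_equal)
  qed
  have E34: "2 * p * u (S (S f)) = (1 + p) * u f - 2 * u (Z * (Z * f)) \<and>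
      - 8 * \<rho> ^ 5 * u (aw_U2 q * D (S f))
      = (1 - p) * ((p\<^sup>2 + 3) * u (Z * f) - 4 * u (Z * (Z * (Z * f))))"
    if L0: "\<And>f. (1 - p) * u (A f) = 2 * u (Z * f)"
    and L1: "\<And>f. p * (1 - p) * u (Z * A f) = 2 * u (Z * (Z * f)) - (1 - p) * u f" for f
  proof -
    define b y where "b = u (aw_U2 q * D (D f))" and "y = u (Z * (aw_U2 q * D (D f)))"
    define x0 x1 x2 where "x0 = u (A f)" and "x1 = u (Z * A f)" and "x2 = u (Z * (Z * A f))"
    define w0 w1 where "w0 = u (A (Z * (Z * f)))" and "w1 = u (Z * A (Z * f))"
    define m0 m1 m2 m3 where "m0 = u f" and "m1 = u (Z * f)" and "m2 = u (Z * (Z * f))"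
      and "m3 = u (Z * (Z * (Z * f)))"
    define \<sigma> \<tau> where "\<sigma> = u (S (S f))" and "\<tau> = u (aw_U2 q * D (S f))"
    note defs = b_def y_def x0_def x1_def x2_def w0_def w1_def m0_def m1_def m2_def m3_def \<sigma>_def \<tau>_def
    have \<beta>: "4 * p * \<beta> = (1 - p)\<^sup>2"
      using \<alpha>' p_def by algebra
    have e: "(1 - p) * x0 = 2 * m1" "(1 - p) * w0 = 2 * m3" "p * (1 - p) * x1 = 2 * m2 - (1 - p) * m0"
      "p * (1 - p) * w1 = 2 * m3 - (1 - p) * m1"
      unfolding defs by (simp_all only: L0 L1)
    have b: "2 * \<rho> ^ 3 * b = (1 - p) * m0 - 2 * m2"
      using E2'[OF L0, of f] L1[of f] unfolding defs by blast
    \<comment> \<open>Everything is now reduced to the moments \<open>m0\<close>, ...,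
      \<open>m3\<close>: \<open>u_relation\<close> with g = 1 supplies the weight z^2, and
      \<open>SS\<close> and \<open>DS\<close> express \<sigma> and \<tau>.\<close>
    have x2: "x2 = 2 * c * w1 - w0 - (c\<^sup>2 - 1) * x0 - (c - 1) * m1"
      using u_relation[of 1 f] unfolding defs by simp
    have y: "2 * \<alpha> * y = w1 - c * x2 - m1"
      unfolding defs by (rule u_Z_Z_A_Z)
    have \<sigma>: "\<sigma> = \<beta> * x1 + \<alpha> * b + m0"
      unfolding defs SS by (simp only: u_simps u_const)
    have "aw_U2 q * D (S f) = [:\<alpha> * \<beta>:] * (Z * (Z * A f)) - [:\<alpha> * \<beta>:] * A f + [:\<beta>:] * (Z * (aw_U2 q * D (D f)))"
      unfolding DS U2_eq unfolding const_hom by algebra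
    then have \<tau>: "\<tau> = \<alpha> * \<beta> * x2 - \<alpha> * \<beta> * x0 + \<beta> * y"
      unfolding defs by (simp only: u_simps u_const)
    have "2 * p * (2 * p * \<sigma> - ((1 + p) * m0 - 2 * m2)) = 0"
    proof -
      have "4 * p\<^sup>2 * (\<beta> * x1) = (1 - p) * (2 * m2 - (1 - p) * m0)" using \<beta> e(3) by algebra
      moreover have "4 * p\<^sup>2 * (\<alpha> * b) = (p + 1) * ((1 - p) * m0 - 2 * m2)"
        using \<alpha>' b p_def by algebra
      ultimately show ?thesis unfolding \<sigma> by algebra
    qed
    then have "2 * p * \<sigma> = (1 + p) * m0 - 2 * m2" using nz by simp
    moreover have "- 8 * \<rho> ^ 5 * \<tau> = (1 - p) * ((p\<^sup>2 + 3) * m1 - 4 * m3)"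
    proof -
      \<comment> \<open>The factor p + 1 = 2 \<alpha> \<rho> is needed because \<open>y\<close> is
        known only through 2 \<alpha> y.\<close>
      have t: "- 8 * \<rho> ^ 5 * (p + 1) * \<tau> = - p * (1 - p)\<^sup>2 * (2 * p * x2 - (p + 1)\<^sup>2 * x0 + 2 * p * w1 - 2 * p * m1)"
      proof -
        have 1: "(p + 1) * y = \<rho> * (w1 - c * x2 - m1)" using y \<alpha>' by algebra
        have "- 8 * \<rho> ^ 5 * (p + 1) * \<tau> = - 8 * \<rho> ^ 5 * \<beta> * ((p + 1) * \<alpha> * (x2 - x0) + (p + 1) * y)"
          unfolding \<tau> by algebra
        also have "\<dots> = - (4 * p * \<beta>) * p * ((p + 1) * (\<alpha> * (2 * \<rho>)) * (x2 - x0) + 2 * p * (w1 - m1) - (c * (2 * p)) * x2)"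
          unfolding 1 unfolding p_def by algebra
        also have "\<dots> = - p * (1 - p)\<^sup>2 * (2 * p * x2 - (p + 1)\<^sup>2 * x0 + 2 * p * w1 - 2 * p * m1)"
          unfolding \<beta> \<alpha>' c' by algebra
        finally show ?thesis .
      qed
      have 2: "2 * p\<^sup>2 * (1 - p) * x2 = 4 * m3 - (2 * (p\<^sup>2 + 1) * (1 - p) + (p\<^sup>2 - 1)\<^sup>2 + p * (1 - p) ^ 3) * m1"
      proof -
        have "2 * p\<^sup>2 * (1 - p) * x2 = 2 * (c * (2 * p)) * (p * (1 - p) * w1) - 2 * p\<^sup>2 * ((1 - p) * w0)
            - ((c * (2 * p))\<^sup>2 - 4 * p\<^sup>2) * ((1 - p) * x0) / 2 - p * (1 - p) * (c * (2 * p) - 2 * p) * m1"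
          unfolding x2 by (simp add: field_simps power2_eq_square)
        also have "\<dots> = 4 * m3 - (2 * (p\<^sup>2 + 1) * (1 - p) + (p\<^sup>2 - 1)\<^sup>2 + p * (1 - p) ^ 3) * m1"
          unfolding e c' by (simp add: field_simps power2_eq_square power3_eq_cube)
        finally show ?thesis .
      qed
      have "(p + 1) * (- 8 * \<rho> ^ 5 * \<tau> - (1 - p) * ((p\<^sup>2 + 3) * m1 - 4 * m3)) = 0"
        using t 2 e(1,4) by algebra
      then show ?thesis using nz by simp
    qed
    ultimately show ?thesis unfolding defs by blast
  qed
  show ?thesis unfolding al_salam_chihara_def E1 E2 E3 E4 using E2' E34 by metis
qed

end

section \<open>The lowering relation determines the functional\<close>

text \<open>The letters k, b, c with an index stand for the first values of \<open>k\<close>,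
  \<open>B\<close>, \<open>C\<close>. The hypotheses \<open>b2\<close>, \<open>b3\<close> are
  coefficients of \<open>P n\<close>, \<open>n1\<close>, \<open>n2\<close> of
  \<open>P (n - 1)\<close>, \<open>n2'\<close>, \<open>n3\<close> of \<open>P (n - 2)\<close>, and
  \<open>n3'\<close> of \<open>P (n - 3)\<close> in the relation applied to
  \<open>P n\<close>.\<close>

lemma lowering_coefficients:
  fixes b0 :: "'a :: field_char_0"
  assumes "c \<noteq> 0" "c \<noteq> 1" "c + 1 \<noteq> 0" "2 * c + 1 \<noteq> 0" "c1 \<noteq> 0"
    and k2: "k2 = c + 1" and k3: "k3 = c * (2 * c + 1)" and k4: "k4 = 2 * c * k3 - k2 - (c - 1)"
    and b1: "b1 = c * b0"
    and b2: "(b0 + b1) - 2 * c * (k2 * b1 + b1) + k2 * (b1 + b2) + (c - 1) * b1 = 0"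
    and b3: "k2 * (b1 + b2) - 2 * c * (k3 * b2 + b2 * k2) + k3 * (b2 + b3) + (c - 1) * b2 = 0"
    and n1: "(c1 + b0\<^sup>2) - 2 * c * (k2 * c1 + b1 * b0) + (c1 + c2 + b1\<^sup>2) + (c\<^sup>2 - 1) + (c - 1) * c1 = 0"
    and n2: "k2 * (c1 + c2 + b1\<^sup>2) - 2 * c * (k3 * c2 + b2 * k2 * b1 + c2) + k2 * (c2 + c3 + b2\<^sup>2) +
      (c\<^sup>2 - 1) * k2 + (c - 1) * c2 = 0"
    and n2': "k2 * c1 * (b1 + b0) - 2 * c * (b2 * k2 * c1 + c2 * b0) + c2 * (b2 + b1) = 0"
    and n3: "k3 * c2 * (b2 + b1) - 2 * c * (b3 * k3 * c2 + c3 * k2 * b1) + k2 * c3 * (b3 + b2) = 0"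
    and n3': "k3 * c2 * c1 - 2 * c * c3 * k2 * c1 + c3 * c2 = 0"
  shows "b0 = 0" "c2 = (c + 1) * ((2 * c - 1) * c1 - (c - 1))"
    "2 * c1\<^sup>2 + 2 * (c - 1) * c1 - (c - 1) = 0"
proof -
  \<comment> \<open>The values of b are b0 times the Chebyshev polynomials c, 2 c^2 - 1, 4 c^3 - 3
    c.\<close>
  have "(c + 1) * (b2 - (2 * c\<^sup>2 - 1) * b0) = 0"
    using b2 unfolding k2 b1 by algebra
  then have b2': "b2 = (2 * c\<^sup>2 - 1) * b0" using assms(3) by simp
  have "(c * (2 * c + 1)) * (b3 - (4 * c ^ 3 - 3 * c) * b0) = 0"
    using b3 unfolding k2 k3 b2' b1 by algebra
  then have b3': "b3 = (4 * c ^ 3 - 3 * c) * b0" using assms(1,4) by simp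
  show "b0 = 0"
  proof (rule ccontr)
    assume "b0 \<noteq> 0"
    \<comment> \<open>If b0 were nonzero, \<open>n2'\<close> and \<open>n3\<close> would make c2 and
      c3 multiples of c1, and \<open>n3'\<close> would become a nonzero multiple of c1^2.\<close>
    have "b0 * ((c - 1) * ((2 * c + 1) * (c2 - (c + 1) * (2 * c + 1) * c1))) = 0"
      using n2' unfolding k2 b2' b1 by algebra
    then have c2': "c2 = (c + 1) * (2 * c + 1) * c1"
      using \<open>b0 \<noteq> 0\<close> assms(2,4) by simp
    have "b0 * ((c - 1) * ((c + 1) * ((2 * c + 1) * ((2 * c + 1) * (c3 - c * (8 * c ^ 3 + 8 * c\<^sup>2 - 1) * c1))))) = 0"
      using n3 unfolding k2 k3 b3' b2' b1 c2' by algebra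
    then have c3': "c3 = c * (8 * c ^ 3 + 8 * c\<^sup>2 - 1) * c1"
      using \<open>b0 \<noteq> 0\<close> assms(2,3,4) by simp
    have "4 * (c1 * (c1 * ((c + 1) * ((c + 1) * ((2 * c + 1) * (c * c)))))) = 0"
      using n3' unfolding k2 k3 c2' c3' by algebra
    then show False using assms(1,3,4,5) by simp
  qed
  then have b: "b0 = 0" "b1 = 0" "b2 = 0" using b1 b2' by simp_all
  show c2': "c2 = (c + 1) * ((2 * c - 1) * c1 - (c - 1))"
  proof -
    have "c1 - 2 * c * ((c + 1) * c1) + (c1 + c2) + (c\<^sup>2 - 1) + (c - 1) * c1 = 0"
      using n1 by (simp add: b k2)
    then show ?thesis by algebra
  qed
  \<comment> \<open>With b0 = 0, \<open>n1\<close> gives c2 = (c + 1) e and \<open>n2\<close> gives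
    c3, both affine in c1; \<open>n3'\<close> then becomes the quadratic equation.\<close>
  define e where "e = (2 * c - 1) * c1 - (c - 1)"
  have "(c + 1) * (c3 - (- c1 - (c\<^sup>2 - 1) + (4 * c ^ 3 + 2 * c\<^sup>2 - c - 1) * e)) = 0"
  proof -
    have "k2 * (c1 + c2) - 2 * c * (k3 * c2 + c2) + k2 * (c2 + c3) + (c\<^sup>2 - 1) * k2 + (c - 1) * c2 = 0"
      using n2 by (simp add: b)
    then show ?thesis unfolding k2 k3 c2' e_def by algebra
  qed
  then have c3': "c3 = - c1 - (c\<^sup>2 - 1) + (4 * c ^ 3 + 2 * c\<^sup>2 - c - 1) * e"
    using assms(3) by simp
  have "2 * (c * (c * ((c - 1) * ((c + 1) * ((2 * c + 1) * (2 * c1\<^sup>2 + 2 * (c - 1) * c1 - (c - 1))))))) = 0"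
    using n3' unfolding k2 k3 c2' c3' e_def by algebra
  then show "2 * c1\<^sup>2 + 2 * (c - 1) * c1 - (c - 1) = 0"
    using assms(1-4) by (simp only: mult_eq_0_iff) simp
qed

context aw_functional
begin

lemma C_0: "C 0 = 0"
  by (simp add: C_def)

text \<open>
  For \<open>n < 3\<close> the truncated indices are harmless: every term with an index that would be negative
  carries a factor \<open>k 0\<close> or \<open>C 0\<close>, which vanish.
\<close>

lemma lowering_relation:
  assumes AP: "\<And>n. A (P n) = smult (k n) (P (n - 1))" and k0: "k 0 = 0"
  shows "smult (k n - 2 * c * k (n + 1) + k (n + 2) + (c - 1)) (P (n + 1))
    + smult (k n * (B (n - 1) + B n) - 2 * c * (k (n + 1) * B n + B n * k n)
        + k (n + 1) * (B n + B (n + 1)) + (c - 1) * B n) (P n)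
    + smult (k n * (C (n - 1) + C n + (B (n - 1))\<^sup>2)
        - 2 * c * (k (n + 1) * C n + B n * k n * B (n - 1) + C n * k (n - 1))
        + k n * (C n + C (n + 1) + (B n)\<^sup>2) + (c\<^sup>2 - 1) * k n + (c - 1) * C n) (P (n - 1))
    + smult (k n * C (n - 1) * (B (n - 1) + B (n - 2))
        - 2 * c * (B n * k n * C (n - 1) + C n * k (n - 1) * B (n - 2))
        + k (n - 1) * C n * (B n + B (n - 1))) (P (n - 2))
    + smult (k n * C (n - 1) * C (n - 2) - 2 * c * C n * k (n - 1) * C (n - 2)
        + k (n - 2) * C n * C (n - 1)) (P (n - 3)) = 0"
proof -
  have AP': "A (P m) = [:k m:] * P (m - 1)" for m by (simp add: AP)
  have rec: "Z * P m = P (Suc m) + [:B m:] * P m + [:C m:] * P (m - 1)" for m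
    using recurrence[of m] by (simp only: mult_pCons_left mult_zero_left pCons_0_0 add_0_right)
  have smult_const: "smult a f = [:a:] * f" for a :: complex and f by simp
  have r0: "Z * P n = P (n + 1) + [:B n:] * P n + [:C n:] * P (n - 1)"
    and r3: "Z * P (n + 1) = P (n + 2) + [:B (n + 1):] * P (n + 1) + [:C (n + 1):] * P n"
    using rec[of n] rec[of "n + 1"] by simp_all
  have r1: "[:k n:] * (Z * P (n - 1)) = [:k n:] * (P n + [:B (n - 1):] * P (n - 1) + [:C (n - 1):] * P (n - 2))"
    and r1': "[:C n:] * (Z * P (n - 1)) = [:C n:] * (P n + [:B (n - 1):] * P (n - 1) + [:C (n - 1):] * P (n - 2))"
  proof -
    \<comment> \<open>At n = 0 the recurrence with truncated indices fails, so \<open>r1\<close> and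
      \<open>r1'\<close> keep the vanishing factors \<open>k n\<close> and
      \<open>C n\<close>.\<close>
    have "n = 0 \<or> Z * P (n - 1) = P n + [:B (n - 1):] * P (n - 1) + [:C (n - 1):] * P (n - 2)"
      using rec[of "n - 1"] by (cases n) (simp_all add: numeral_2_eq_2)
    then show "[:k n:] * (Z * P (n - 1)) = [:k n:] * (P n + [:B (n - 1):] * P (n - 1) + [:C (n - 1):] * P (n - 2))"
      "[:C n:] * (Z * P (n - 1)) = [:C n:] * (P n + [:B (n - 1):] * P (n - 1) + [:C (n - 1):] * P (n - 2))"
      using k0 C_0 by (elim disjE; simp only: pCons_0_0 mult_zero_left)+
  qed
  have "n \<le> 1 \<or> Z * P (n - 2) = P (n - 1) + [:B (n - 2):] * P (n - 2) + [:C (n - 2):] * P (n - 3)"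
    using rec[of "n - 2"] by (cases "n \<le> 1") (auto simp: Suc_diff_Suc numeral_3_eq_3 numeral_2_eq_2)
  moreover have "[:k n:] * [:C (n - 1):] = 0" "[:C n:] * [:k (n - 1):] = 0" if "n \<le> 1"
    using that k0 by (auto simp: C_def)
  ultimately have r2: "[:k n:] * [:C (n - 1):] * (Z * P (n - 2)) 
       = [:k n:] * [:C (n - 1):] * (P (n - 1) + [:B (n - 2):] * P (n - 2) + [:C (n - 2):] * P (n - 3))"
    and r2': "[:C n:] * [:k (n - 1):] * (Z * P (n - 2)) 
       = [:C n:] * [:k (n - 1):] * (P (n - 1) + [:B (n - 2):] * P (n - 2) + [:C (n - 2):] * P (n - 3))"
    by (metis mult_zero_left)+
  have A_Z_P: "A (Z * P n) = [:k (n + 1):] * P n + [:B n:] * ([:k n:] * P (n - 1)) + [:C n:] * ([:k (n - 1):] * P (n - 2))"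
    unfolding r0 op_simps AP' by (simp add: numeral_2_eq_2)
  have A_Z_P': "A (Z * P (n + 1)) = [:k (n + 2):] * P (n + 1) + [:B (n + 1):] * ([:k (n + 1):] * P n)
      + [:C (n + 1):] * ([:k n:] * P (n - 1))"
    unfolding r3 op_simps AP' by simp
  have A_Z_P'': "[:C n:] * A (Z * P (n - 1)) = [:C n:] * ([:k n:] * P (n - 1) + [:B (n - 1):] * ([:k (n - 1):] * P (n - 2))
      + [:C (n - 1):] * ([:k (n - 2):] * P (n - 3)))"
  proof -
    have "[:C n:] * A (Z * P (n - 1)) = A ([:C n:] * (Z * P (n - 1)))" by (simp only: op_simps)
    also have "\<dots> = [:C n:] * ([:k n:] * P (n - 1) + [:B (n - 1):] * ([:k (n - 1):] * P (n - 2))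
      + [:C (n - 1):] * ([:k (n - 2):] * P (n - 3)))"
      unfolding r1' op_simps AP' by (simp add: numeral_2_eq_2 numeral_3_eq_3)
    finally show ?thesis .
  qed
  have "A (Z * (Z * P n)) = A (Z * P (n + 1)) + [:B n:] * A (Z * P n) + [:C n:] * A (Z * P (n - 1))"
  proof -
    have "Z * (Z * P n) = Z * P (n + 1) + [:B n:] * (Z * P n) + [:C n:] * (Z * P (n - 1))"
      by (subst r0) algebra
    then show ?thesis by (simp only: op_simps)
  qed
  then have "Z * ([:k n:] * (Z * P (n - 1))) - 2 * [:c:] * (Z * A (Z * P n))
      + (A (Z * P (n + 1)) + [:B n:] * A (Z * P n) + [:C n:] * A (Z * P (n - 1)))
      + ([:c:]\<^sup>2 - 1) * ([:k n:] * P (n - 1)) + ([:c:] - 1) * (Z * P n) = 0"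
    using A_relation[of "P n"] unfolding AP' by algebra
  note sum = this[unfolded A_Z_P' A_Z_P'' A_Z_P]
  have zz: "Z * ([:k n:] * (Z * P (n - 1))) = [:k n:] * (Z * P n) + [:B (n - 1):] * ([:k n:] * (Z * P (n - 1)))
      + [:k n:] * [:C (n - 1):] * (Z * P (n - 2))" (is "?l = ?r")
  proof -
    have "?l = Z * ([:k n:] * (P n + [:B (n - 1):] * P (n - 1) + [:C (n - 1):] * P (n - 2)))"
      by (simp only: r1)
    also have "\<dots> = ?r" by algebra
    finally show ?thesis .
  qed
  have za: "Z * ([:k (n + 1):] * P n + [:B n:] * ([:k n:] * P (n - 1)) + [:C n:] * ([:k (n - 1):] * P (n - 2)))
      = [:k (n + 1):] * (Z * P n) + [:B n:] * ([:k n:] * (Z * P (n - 1)))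
      + [:C n:] * [:k (n - 1):] * (Z * P (n - 2))"
    by algebra
  from sum[unfolded zz za, unfolded r0 r1 r2 r2'] show ?thesis
    unfolding smult_const const_hom by - (erule trans[rotated], algebra)
qed

text \<open>Pairing with one basis element isolates a coefficient. For n < 3 several truncated
  indices coincide at 0, so the coefficients colliding there must already be known to
  vanish.\<close>

lemma P_coefficients_eq_0:
  assumes "smult e4 (P (n + 1)) + smult e3 (P n) + smult e2 (P (n - 1)) + smult e1 (P (n - 2)) + smult e0 (P (n - 3)) = 0"
  shows "e4 = 0" and "n \<ge> 1 \<or> e2 = 0 \<and> e1 = 0 \<and> e0 = 0 \<Longrightarrow> e3 = 0"
    and "n \<ge> 2 \<or> n = 1 \<and> e1 = 0 \<and> e0 = 0 \<Longrightarrow> e2 = 0"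
    and "n \<ge> 3 \<or> n = 2 \<and> e0 = 0 \<Longrightarrow> e1 = 0"
    and "n \<ge> 3 \<Longrightarrow> e0 = 0"
proof -
  have e: "e4 * u (P j * P (n + 1)) + e3 * u (P j * P n) + e2 * u (P j * P (n - 1))
      + e1 * u (P j * P (n - 2)) + e0 * u (P j * P (n - 3)) = 0" for j
  proof -
    have "u (P j * (smult e4 (P (n + 1)) + smult e3 (P n) + smult e2 (P (n - 1)) + smult e1 (P (n - 2))
      + smult e0 (P (n - 3)))) = 0"
      unfolding assms by (simp add: u_simps)
    then show ?thesis by (simp only: distrib_left mult_smult_right u_simps)
  qed
  show "e4 = 0" using e[of "n + 1"] h_nonzero[of "n + 1"] unfolding u_P_P by (simp split: if_splits)
  show "e3 = 0" if "n \<ge> 1 \<or> e2 = 0 \<and> e1 = 0 \<and> e0 = 0"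
    using e[of n] h_nonzero[of n] that unfolding u_P_P by (auto split: if_splits)
  show "e2 = 0" if "n \<ge> 2 \<or> n = 1 \<and> e1 = 0 \<and> e0 = 0"
    using e[of "n - 1"] h_nonzero[of "n - 1"] that unfolding u_P_P by (auto split: if_splits)
  show "e1 = 0" if "n \<ge> 3 \<or> n = 2 \<and> e0 = 0"
    using e[of "n - 2"] h_nonzero[of "n - 2"] that unfolding u_P_P by (auto split: if_splits)
  show "e0 = 0" if "n \<ge> 3"
    using e[of "n - 3"] h_nonzero[of "n - 3"] that unfolding u_P_P by (auto split: if_splits)
qed

text \<open>The coefficients determine \<open>B 0\<close>, \<open>C 1\<close> and \<open>C 2\<close>
  in terms of p; comparing both sides on the basis then identifies the functionals f ->
  \<open>u (A f)\<close> and f -> \<open>u (Z * A f)\<close>.\<close>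

lemma al_salam_chihara_if_lowering:
  assumes AP: "\<And>n. A (P n) = smult (k n) (P (n - 1))" and k0: "k 0 = 0"
  shows "\<exists>p \<in> {of_real q, 1 / of_real q}. al_salam_chihara p"
proof -
  note R = lowering_relation[OF AP k0]
  note E4 = P_coefficients_eq_0(1)[OF R] and E3 = P_coefficients_eq_0(2)[OF R]
    and E2 = P_coefficients_eq_0(3)[OF R] and E1 = P_coefficients_eq_0(4)[OF R]
    and E0 = P_coefficients_eq_0(5)[OF R]
  have P1: "P 1 = Z - [:B 0:]"
    using recurrence[of 0] C_0 by (simp add: P_0)
  have k1: "k 1 = 1"
  proof -
    have "A Z = 1" using A_Z[of 1] D_const[of 1] by (simp add: one_pCons S_0 D_0)
    then have "A (P 1) = 1" unfolding P1 by (simp only: op_simps diff_0_right)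
    then show ?thesis using AP[of 1] by (simp add: P_0 one_pCons)
  qed
  have C: "C (Suc n) \<noteq> 0" for n using h_nonzero by (simp add: C_def)
  have E4': "k n - 2 * c * k (n + 1) + k (n + 2) + (c - 1) = 0" for n
    by (rule E4)
  have k2: "k 2 = c + 1" using E4'[of 0, unfolded add_0] k0 k1 by algebra
  have k3: "k 3 = c * (2 * c + 1)"
  proof -
    have "k 1 - 2 * c * k 2 + k 3 + (c - 1) = 0" using E4'[of 1] by (simp only: one_add_one numeral_plus_one semiring_norm)
    then show ?thesis using k1 k2 by algebra
  qed
  have k4: "k 4 = 2 * c * k 3 - k 2 - (c - 1)"
  proof -
    have "k 2 - 2 * c * k 3 + k 4 + (c - 1) = 0" using E4'[of 2] by (simp only: one_add_one numeral_plus_one semiring_norm numeral_plus_numeral)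
    then show ?thesis by algebra
  qed
  have b1: "B 1 = c * B 0"
  proof -
    have "- 2 * c * B 0 + (B 0 + B 1) + (c - 1) * B 0 = 0"
      using E3[of 0] k0 k1 C_0 by simp
    then show ?thesis by algebra
  qed
  have b2: "(B 0 + B 1) - 2 * c * (k 2 * B 1 + B 1) + k 2 * (B 1 + B 2) + (c - 1) * B 1 = 0"
    using E3[of 1] k1 by (simp add: numeral_2_eq_2)
  have b3: "k 2 * (B 1 + B 2) - 2 * c * (k 3 * B 2 + B 2 * k 2) + k 3 * (B 2 + B 3) + (c - 1) * B 2 = 0"
    using E3[of 2] by simp
  have n1: "(C 1 + (B 0)\<^sup>2) - 2 * c * (k 2 * C 1 + B 1 * B 0) + (C 1 + C 2 + (B 1)\<^sup>2) + (c\<^sup>2 - 1) + (c - 1) * C 1 = 0"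
    using E2[of 1] k0 k1 C_0 by (simp add: numeral_2_eq_2)
  have n2: "k 2 * (C 1 + C 2 + (B 1)\<^sup>2) - 2 * c * (k 3 * C 2 + B 2 * k 2 * B 1 + C 2) + k 2 * (C 2 + C 3 + (B 2)\<^sup>2) +
      (c\<^sup>2 - 1) * k 2 + (c - 1) * C 2 = 0"
    using E2[of 2] k1 by simp
  have n2': "k 2 * C 1 * (B 1 + B 0) - 2 * c * (B 2 * k 2 * C 1 + C 2 * B 0) + C 2 * (B 2 + B 1) = 0"
    using E1[of 2] k0 k1 C_0 by simp
  have n3: "k 3 * C 2 * (B 2 + B 1) - 2 * c * (B 3 * k 3 * C 2 + C 3 * k 2 * B 1) + k 2 * C 3 * (B 3 + B 2) = 0"
    using E1[of 3] by simp
  have n3': "k 3 * C 2 * C 1 - 2 * c * C 3 * k 2 * C 1 + C 3 * C 2 = 0"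
    using E0[of 3] k1 by simp
  have "C 1 \<noteq> 0" using C[of 0] by simp
  note coeffs = lowering_coefficients[OF c_nonzero this k2 k3 k4 b1 b2 b3 n1 n2 n2' n3 n3']
  \<comment> \<open>In terms of p the quadratic equation for \<open>C 1\<close> reads p^2 + 1 = 2 c
    p, whose roots are q and 1/q.\<close>
  define p where "p = 1 - 2 * C 1"
  define Q where "Q = complex_of_real q"
  have Q: "Q \<noteq> 0" using q by (simp add: Q_def)
  have cQ: "c * (2 * Q) = Q\<^sup>2 + 1"
    unfolding c_eq using q by (simp add: Q_def field_simps power2_eq_square)
  have "(p - Q) * (p * Q - 1) = 0"
    using coeffs(3) cQ p_def by algebra
  then have p_or: "p = Q \<or> p * Q = 1" by (simp only: mult_eq_0_iff right_minus_eq)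
  then have p_cases: "p \<in> {Q, 1 / Q}"
    using Q by (auto simp: eq_divide_eq)
  then have p: "p \<noteq> 0" "1 - p \<noteq> 0"
    using Q \<open>C 1 \<noteq> 0\<close> by (auto simp: p_def)
  have cp: "c * (2 * p) = p\<^sup>2 + 1"
    using p_or
  proof
    assume "p * Q = 1"
    then show ?thesis using cQ by algebra
  qed (simp only: cQ)
  have Z1: "P 1 = Z" using P1 coeffs(1) by simp
  have Z2: "P 2 = Z * Z - [:C 1:]"
  proof -
    have B1: "B 1 = 0" using coeffs(1) b1 by simp
    have "Z * P 1 = P 2 + smult (B 1) (P 1) + smult (C 1) (P 0)"
      using recurrence[of 1] by (simp only: Suc_1 diff_self_eq_0)
    then have "Z * Z = P 2 + smult 0 Z + smult (C 1) 1"
      unfolding Z1 P_0 B1 .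
    moreover have "smult (C 1) 1 = [:C 1:]" by simp
    ultimately show ?thesis by (simp only: smult_0_left add_0_right eq_diff_eq)
  qed
  have h: "h 1 = C 1 * h 0" "h 2 = C 2 * h 1" using h_nonzero by (simp_all add: C_def numeral_2_eq_2)
  \<comment> \<open>On the basis both sides are nonzero only at n = 1, where they agree because
    \<open>k 1 = 1\<close> and \<open>h 1 = C 1 * h 0\<close>. In \<open>L1\<close> the same happens
    at n = 2.\<close>
  have L0: "C 1 * u (A f) = u (P 1 * f)" for f
  proof (rule functional_eqI[where v = "\<lambda>f. C 1 * u (A f)" and w = "\<lambda>f. u (P 1 * f)"])
    show "C 1 * u (A (P n)) = u (P 1 * P n)" for n
    proof -
      have u_P: "u (P m) = (if 0 = m then h 0 else 0)" for m
        using u_P_P[of 0 m] unfolding P_0 by (cases "m = 0") simp_all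
      show ?thesis
        unfolding AP u_simps u_P u_P_P using k0 k1 h(1) by (cases "n = 0") auto
    qed
  qed (simp_all add: D_add S_add D_smult S_smult u_simps D_0 S_0 distrib_left)
  have L1: "C 2 * u (P 1 * A f) = k 2 * u (P 2 * f)" for f
  proof (rule functional_eqI[where v = "\<lambda>f. C 2 * u (P 1 * A f)" and w = "\<lambda>f. k 2 * u (P 2 * f)"])
    show "C 2 * u (P 1 * A (P n)) = k 2 * u (P 2 * P n)" for n
      unfolding AP mult_smult_right u_simps u_P_P using k0 h(2) by (cases "n = 0") auto
  qed (simp_all add: D_add S_add D_smult S_smult u_simps D_0 S_0 distrib_left)
  have "al_salam_chihara p"
    unfolding al_salam_chihara_def
  proof (intro allI conjI)
    fix f
    show "(1 - p) * u (A f) = 2 * u (Z * f)"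
      using L0[of f] unfolding Z1 by (simp add: p_def)
    have "P 2 * f = Z * (Z * f) - [:C 1:] * f" unfolding Z2 by algebra
    then have "C 2 * u (Z * A f) = k 2 * (u (Z * (Z * f)) - C 1 * u f)"
      using L1[of f] unfolding Z1 by (simp only: u_simps u_const)
    then have "C 2 * (2 * p * u (Z * A f)) = (c + 1) * p * (2 * u (Z * (Z * f)) - (1 - p) * u f)"
      unfolding k2 using p_def by algebra
    moreover have "2 * C 2 = (c + 1) * p * (1 - p)"
      using coeffs(2) p_def cp by algebra
    ultimately have "((c + 1) * p) * (p * (1 - p) * u (Z * A f) - (2 * u (Z * (Z * f)) - (1 - p) * u f)) = 0"
      by algebra
    then show "p * (1 - p) * u (Z * A f) = 2 * u (Z * (Z * f)) - (1 - p) * u f"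
      using p c_nonzero by simp
  qed
  then show ?thesis using p_cases unfolding Q_def by blast
qed

end

theorem theorem3p2:
  fixes q :: real and u :: "complex poly \<Rightarrow> complex" and P :: "nat \<Rightarrow> complex poly"
  assumes "0 < q" and "q < 1"
    and "u \<in> poly_dual"
    and "regular_functional u"
    and "monic_OPS u P"
  shows "(\<exists>k :: nat \<Rightarrow> complex. \<forall>n.
            aw_S q (aw_D q (P n)) = smult (k n) (if n = 0 then 0 else P (n - 1)))
     \<longleftrightarrow>
         (\<exists>s \<in> {1, -1 :: real}.
            dual_scale (of_real (q powr s - 1)) (dual_D q (dual_S q u))
              = dual_mult [:0, 2:] u
          \<and> dual_scale (of_real (2 * q powr (3 * s / 2))) (dual_D q (dual_D q (dual_mult (aw_U2 q) u)))
              = dual_mult (- [:of_real (q powr s - 1), 0, 2:]) u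
          \<and> dual_scale (of_real (2 * q powr s)) (dual_S q (dual_S q u))
              = dual_mult [:of_real (1 + q powr s), 0, -2:] u
          \<and> dual_scale (of_real (8 * q powr (5 * s / 2))) (dual_S q (dual_D q (dual_mult (aw_U2 q) u)))
              = dual_mult (smult (of_real (1 - q powr s))
                  ([:0, 1:] * [:of_real (q powr (2 * s) + 3), 0, -4:])) u)"
proof -
  obtain h where "aw_functional q u P h"
    using assms unfolding monic_OPS_def aw_functional_def aw_operators_def monic_orthogonal_def by metis
  then interpret aw_functional q u P h .
  have L: "(\<exists>k. \<forall>n. A (P n) = smult (k n) (if n = 0 then 0 else P (n - 1)))
      \<longleftrightarrow> (\<exists>p \<in> {of_real q, 1 / of_real q}. al_salam_chihara p)" (is "?lhs \<longleftrightarrow> ?rhs")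
  proof
    assume ?lhs
    then obtain k where k: "\<And>n. A (P n) = smult (k n) (if n = 0 then 0 else P (n - 1))" by blast
    \<comment> \<open>At n = 0 the right-hand side is 0 for any \<open>k 0\<close>, so
      \<open>k 0\<close> may be reset to 0; the truncated index in \<open>P (n - 1)\<close> is then
      harmless.\<close>
    show ?rhs
      by (rule al_salam_chihara_if_lowering[of "\<lambda>n. if n = 0 then 0 else k n"]) (simp_all add: k)
  next
    assume ?rhs
    then obtain p where p: "al_salam_chihara p" "p \<noteq> 0" "p \<noteq> 1" using assms(1,2) by auto
    \<comment> \<open>The two equations of \<open>al_salam_chihara\<close>, divided by 1 - p and by
      p (1 - p).\<close>
    let ?L0 = "smult (2 / (1 - p)) Z"
      and ?L1 = "smult (1 / (p * (1 - p))) ([:2:] * (Z * Z) - [:1 - p:])"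
    have "u (A f) = u (?L0 * f)" for f
    proof -
      have L0: "u (?L0 * f) = 2 / (1 - p) * u (Z * f)" by (simp only: mult_smult_left u_simps)
      have "(1 - p) * u (A f) = 2 * u (Z * f)" using p(1) unfolding al_salam_chihara_def by blast
      then show ?thesis unfolding L0 using p(3) by (simp add: field_simps)
    qed
    moreover have "u (Z * A f) = u (?L1 * f)" for f
    proof -
      have L1: "u (?L1 * f) = 1 / (p * (1 - p)) * (2 * u (Z * (Z * f)) - (1 - p) * u f)"
        by (simp only: mult_smult_left left_diff_distrib mult.assoc u_simps u_const)
      have "p * (1 - p) * u (Z * A f) = 2 * u (Z * (Z * f)) - (1 - p) * u f"
        using p(1) unfolding al_salam_chihara_def by blast
      then show ?thesis unfolding L1 using p(2,3) by (simp add: field_simps)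
    qed
    moreover have "degree ?L0 \<le> 1" "degree ?L1 \<le> 2" by (simp_all add: degree_diff_le)
    ultimately show ?lhs using lowering_if_functional by blast
  qed
  have E: "al_salam_chihara (of_real (q powr s)) \<longleftrightarrow>
            dual_scale (of_real (q powr s - 1)) (dual_D q (dual_S q u))
              = dual_mult [:0, 2:] u
          \<and> dual_scale (of_real (2 * q powr (3 * s / 2))) (dual_D q (dual_D q (dual_mult (aw_U2 q) u)))
              = dual_mult (- [:of_real (q powr s - 1), 0, 2:]) u
          \<and> dual_scale (of_real (2 * q powr s)) (dual_S q (dual_S q u))
              = dual_mult [:of_real (1 + q powr s), 0, -2:] u
          \<and> dual_scale (of_real (8 * q powr (5 * s / 2))) (dual_S q (dual_D q (dual_mult (aw_U2 q) u)))
              = dual_mult (smult (of_real (1 - q powr s))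
                  ([:0, 1:] * [:of_real (q powr (2 * s) + 3), 0, -4:])) u"
    if "s \<in> {1, -1}" for s :: real
  proof -
    \<comment> \<open>This r is the \<rho> of \<open>functional_equations_iff\<close>; for s = -1 it
      is the inverse of the square root of q, which leaves r + 1/r unchanged.\<close>
    define r where "r = q powr (s / 2)"
    have r: "0 < r" using assms(1) by (simp add: r_def)
    have pw: "q powr (real n * s / 2) = r ^ n" for n
      unfolding r_def using assms(1) by (simp add: powr_powr powr_realpow[symmetric] mult.commute)
    have r2: "q powr s = r\<^sup>2" and r3: "q powr (3 * s / 2) = r ^ 3" and r5: "q powr (5 * s / 2) = r ^ 5"
      and r4: "q powr (2 * s) = (r\<^sup>2)\<^sup>2"
      using pw[of 2] pw[of 3] pw[of 5] pw[of 4] by simp_all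
    have "r\<^sup>2 \<noteq> 1"
      using that assms(1,2) unfolding r2[symmetric] by (auto simp: powr_minus)
    then have "(complex_of_real r)\<^sup>2 \<noteq> 1"
      by (metis of_real_eq_1_iff of_real_power)
    moreover have "(complex_of_real r)\<^sup>2 \<noteq> - 1"
    proof -
      have "r\<^sup>2 \<noteq> - 1" using zero_le_power2[of r] by linarith
      then show ?thesis by (metis of_real_1 of_real_minus of_real_eq_iff of_real_power)
    qed
    moreover have "2 * \<alpha> = complex_of_real r + 1 / complex_of_real r"
    proof -
      have "2 * aw_alpha q = r + 1 / r"
        using that unfolding aw_alpha_def r_def by (auto simp: powr_minus_divide)
      then show ?thesis by (metis of_real_1 of_real_add of_real_divide of_real_mult of_real_numeral)
    qed
    ultimately have F: "complex_of_real r \<noteq> 0" "(complex_of_real r)\<^sup>2 \<noteq> 1" "(complex_of_real r)\<^sup>2 \<noteq> - 1"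
      "2 * \<alpha> = complex_of_real r + 1 / complex_of_real r"
      using r by simp_all
    show ?thesis
      using functional_equations_iff[OF F]
      unfolding r2 r3 r4 r5
      by (simp only: of_real_diff of_real_add of_real_mult of_real_power of_real_1 of_real_numeral)
  qed
  have "q powr 1 = q" "q powr -1 = 1 / q" using assms(1) by (simp_all add: powr_minus_divide)
  then show ?thesis
    unfolding L using E[of 1] E[of "-1"] by simp
qed

end
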